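(* Let $k\ge 2$, let $\alpha_1,\alpha_2\in\mathbb{R}$ with $\alpha_1\neq\alpha_2$, let $K:=\{(x,y)\in\mathbb{R}^2: (y-\alpha_1)(y-\alpha_2)=0\}$ and let $\beta=(\beta_{i,j})_{i,j\in\mathbb{Z}_+,\,i+j\le 2k}$ be a real bivariate sequence of degree $2k$ with $\beta_{0,0}>0$ and moment matrix $M_k=M_k(\beta)$. Let $A_1,B_1,M,N$ be the matrices built from $\beta$ defined in the context. Then the following statements are equivalent: (1) $\beta$ has a $K$-representing measure. (2) $\beta$ has a $(\operatorname{rank} M_k)$-atomic $K$-representing measure. (3) $M_k$ is positive semidefinite, recursively generated and satisfies the column relation $(Y-\alpha_1)(Y-\alpha_2)=\mathbf{0}$. (4) $M$ is positive semidefinite, the relations $$\beta_{i,j+2}=(\alpha_1+\alpha_2)\,\beta_{i,j+1}-\alpha_1\alpha_2\,\beta_{i,j}$$ hold for every $i,j\in\mathbb{Z}_+$ with $i+j\le 2k-2$, and one of the following statements holds: (a) $B_1-\alpha_1A_1$ is invertible; (b) $\alpha_2A_1-B_1$ is invertible; (c) $\operatorname{rank} M=\operatorname{rank} N$.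
   Context: $\mathbb{Z}_+$ denotes the nonnegative integers. For closed $K\subseteq\mathbb{R}^2$, a $K$-representing measure for $\beta=(\beta_{i,j})_{i+j\le 2k}$ is a positive Borel measure $\mu$ with support contained in $K$ such that $\beta_{i,j}=\int_K x^iy^j\,d\mu$ for all $i,j\in\mathbb{Z}_+$ with $i+j\le 2k$. A measure is $r$-atomic if it is of the form $\sum_{j=1}^r\rho_j\delta_{z_j}$ with $\rho_j>0$ and pairwise distinct points $z_j\in\mathbb{R}^2$. The moment matrix $M_k=M_k(\beta)$ has rows and columns indexed by the monomials $X^iY^j$, $i+j\le k$; the entry in row $X^{i}Y^{j}$ and column $X^{i'}Y^{j'}$ is $\beta_{i+i',j+j'}$. For a polynomial $p=\sum_{i+j\le k}a_{i,j}x^iy^j$ write $p(X,Y)=\sum a_{i,j}X^iY^j$ for the corresponding linear combination of columns of $M_k$; an equality $p(X,Y)=\mathbf{0}$ is a column relation of $M_k$. $M_k$ is recursively generated if whenever $p,q,pq$ are polynomials of degree at most $k$ with $p(X,Y)=\mathbf 0$, also $(pq)(X,Y)=\mathbf 0$. Matrices: - $M$ is the $(2k+1)\times(2k+1)$ restriction of $M_k$ to the rows and columns indexed by $1,X,\dots,X^{k},Y,YX,\dots,YX^{k-1}$ (in this order). - $N$ is the $2k\times 2k$ restriction of $M_k$ to the rows and columns indexed by $1,X,\dots,X^{k-1},Y,YX,\dots,YX^{k-1}$. - $A_1=(\beta_{i+j,0})_{0\le i,j\le k-1}$ and $B_1=(\beta_{i+j,1})_{0\le i,j\le k-1}$, both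 $k\times k$ (these are the blocks of $N$ with rows $1,\dots,X^{k-1}$ and columns $1,\dots,X^{k-1}$, respectively $Y,\dots,YX^{k-1}$). *)

theory Defs
  imports
    "HOL-Probability.Probability"
    "HOL-Computational_Algebra.Polynomial"
    "Jordan_Normal_Form.DL_Rank"
begin

text \<open>
  A bivariate sequence of degree \<open>2 * k\<close> is a function \<open>\<beta> :: nat \<Rightarrow> nat \<Rightarrow> real\<close>;
  every definition below only reads the values \<open>\<beta> i j\<close> with \<open>i + j \<le> 2 * k\<close>.
\<close>

section \<open>Representing measures\<close>

definition measure_support :: "(real \<times> real) measure \<Rightarrow> (real \<times> real) set" where
  "measure_support \<mu> = {z. \<forall>U. open U \<and> z \<in> U \<longrightarrow> emeasure \<mu> U > 0}"

text \<open>
  Integrability is demanded explicitly because the Bochner integral of a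
  non-integrable function is 0. The case \<open>i = j = 0\<close> makes \<open>\<mu>\<close> finite.
\<close>

definition representing_measure ::
    "(real \<times> real) set \<Rightarrow> nat \<Rightarrow> (nat \<Rightarrow> nat \<Rightarrow> real) \<Rightarrow> (real \<times> real) measure \<Rightarrow> bool" where
  "representing_measure K k \<beta> \<mu> \<longleftrightarrow>
     sets \<mu> = sets borel \<and> measure_support \<mu> \<subseteq> K \<and>
     (\<forall>i j. i + j \<le> 2 * k \<longrightarrow>
        integrable \<mu> (\<lambda>(x, y). x ^ i * y ^ j) \<and>
        \<beta> i j = (\<integral>(x, y). x ^ i * y ^ j \<partial>\<mu>))"

text \<open>The Dirac measure at \<open>z\<close> is \<open>return borel z\<close>.\<close>

definition atomic_measure :: "nat \<Rightarrow> (real \<times> real) measure \<Rightarrow> bool" where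
  "atomic_measure r \<mu> \<longleftrightarrow>
     sets \<mu> = sets borel \<and>
     (\<exists>(\<rho> :: nat \<Rightarrow> real) (z :: nat \<Rightarrow> real \<times> real).
        (\<forall>j<r. \<rho> j > 0) \<and> inj_on z {..<r} \<and>
        (\<forall>S \<in> sets borel. emeasure \<mu> S = (\<Sum>j<r. ennreal (\<rho> j) * emeasure (return borel (z j)) S)))"

section \<open>Moment matrices\<close>

text \<open>The monomial \<open>X^i Y^j\<close> is encoded as the pair \<open>(i, j)\<close>.\<close>

definition moment_submatrix ::
    "(nat \<Rightarrow> nat \<Rightarrow> real) \<Rightarrow> (nat \<times> nat) list \<Rightarrow> real mat" where
  "moment_submatrix \<beta> ms =
     mat (length ms) (length ms)
       (\<lambda>(r, c). \<beta> (fst (ms ! r) + fst (ms ! c)) (snd (ms ! r) + snd (ms ! c)))"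

text \<open>Degree-lexicographic order: \<open>1, X, Y, X^2, XY, Y^2, \<dots>\<close>\<close>

definition monomials_upto :: "nat \<Rightarrow> (nat \<times> nat) list" where
  "monomials_upto k = concat (map (\<lambda>d. map (\<lambda>j. (d - j, j)) [0..<d + 1]) [0..<k + 1])"

definition moment_matrix :: "nat \<Rightarrow> (nat \<Rightarrow> nat \<Rightarrow> real) \<Rightarrow> real mat" where
  "moment_matrix k \<beta> = moment_submatrix \<beta> (monomials_upto k)"

definition mat_M :: "nat \<Rightarrow> (nat \<Rightarrow> nat \<Rightarrow> real) \<Rightarrow> real mat" where
  "mat_M k \<beta> =
     moment_submatrix \<beta> (map (\<lambda>i. (i, 0)) [0..<k + 1] @ map (\<lambda>i. (i, 1)) [0..<k])"

definition mat_N :: "nat \<Rightarrow> (nat \<Rightarrow> nat \<Rightarrow> real) \<Rightarrow> real mat" where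
  "mat_N k \<beta> =
     moment_submatrix \<beta> (map (\<lambda>i. (i, 0)) [0..<k] @ map (\<lambda>i. (i, 1)) [0..<k])"

definition mat_A1 :: "nat \<Rightarrow> (nat \<Rightarrow> nat \<Rightarrow> real) \<Rightarrow> real mat" where
  "mat_A1 k \<beta> = mat k k (\<lambda>(i, j). \<beta> (i + j) 0)"

definition mat_B1 :: "nat \<Rightarrow> (nat \<Rightarrow> nat \<Rightarrow> real) \<Rightarrow> real mat" where
  "mat_B1 k \<beta> = mat k k (\<lambda>(i, j). \<beta> (i + j) 1)"

definition psd :: "real mat \<Rightarrow> bool" where
  "psd A \<longleftrightarrow> square_mat A \<and> transpose_mat A = A \<and>
     (\<forall>v \<in> carrier_vec (dim_row A). v \<bullet> (A *\<^sub>v v) \<ge> 0)"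

abbreviation mat_rank :: "real mat \<Rightarrow> nat" where
  "mat_rank A \<equiv> vec_space.rank (dim_row A) A"

section \<open>Column relations\<close>

text \<open>
  Bivariate polynomials are of type \<open>real poly poly\<close>, the outer variable being \<open>y\<close>
  and the inner one \<open>x\<close>; so \<open>bicoeff p i j\<close> is the coefficient of \<open>x^i y^j\<close>.
\<close>

definition bicoeff :: "real poly poly \<Rightarrow> nat \<Rightarrow> nat \<Rightarrow> real" where
  "bicoeff p i j = Polynomial.coeff (Polynomial.coeff p j) i"

definition total_degree_le :: "nat \<Rightarrow> real poly poly \<Rightarrow> bool" where
  "total_degree_le d p \<longleftrightarrow> (\<forall>i j. bicoeff p i j \<noteq> 0 \<longrightarrow> i + j \<le> d)"

text \<open>\<open>p(X, Y)\<close> as a linear combination of columns of the moment matrix, for \<open>p\<close> of degree \<open>\<le> k\<close>.\<close>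

definition column_eval :: "nat \<Rightarrow> (nat \<Rightarrow> nat \<Rightarrow> real) \<Rightarrow> real poly poly \<Rightarrow> real vec" where
  "column_eval k \<beta> p =
     moment_matrix k \<beta> *\<^sub>v vec_of_list (map (\<lambda>(i, j). bicoeff p i j) (monomials_upto k))"

definition column_relation :: "nat \<Rightarrow> (nat \<Rightarrow> nat \<Rightarrow> real) \<Rightarrow> real poly poly \<Rightarrow> bool" where
  "column_relation k \<beta> p \<longleftrightarrow>
     total_degree_le k p \<and> column_eval k \<beta> p = 0\<^sub>v (dim_row (moment_matrix k \<beta>))"

definition recursively_generated :: "nat \<Rightarrow> (nat \<Rightarrow> nat \<Rightarrow> real) \<Rightarrow> bool" where
  "recursively_generated k \<beta> \<longleftrightarrow>
     (\<forall>p q. total_degree_le k p \<and> total_degree_le k q \<and> total_degree_le k (p * q) \<and>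
        column_relation k \<beta> p \<longrightarrow> column_relation k \<beta> (p * q))"

end

theory Submission
  imports Defs "Jordan_Normal_Form.Char_Poly"
begin

text \<open>
  The recurrence splits \<open>\<beta>\<close> into two univariate sequences, one for each line, and leaves free only how
  \<open>\<beta> (2 * k) 0\<close> is distributed among their top moments. Positivity of \<open>M\<close> forces each of them, with its
  smallest admissible top moment, to be given by a Gauss quadrature with at most \<open>k\<close> nodes; what then remains of
  \<open>\<beta> (2 * k) 0\<close> is an excess \<open>\<delta> \<ge> 0\<close>. Thus \<open>rank M - rank N\<close> is 0 or 1 according to whether \<open>\<delta> = 0\<close>, and
  the matrices in (a) and (b) are invertible iff the quadrature on the second, respectively first, line has
  exactly \<open>k\<close> nodes. In that case the excess can be absorbed there by a quadrature with \<open>k + 1\<close> nodes.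
  Conversely, if both quadratures have fewer than \<open>k\<close> nodes, there are monic \<open>f\<close>, \<open>g\<close> of degree \<open>k - 1\<close>
  vanishing on them, so that \<open>p = f (y - \<alpha>2) - g (y - \<alpha>1)\<close> is a column relation of degree \<open>k - 1\<close>, and
  the relation \<open>x p\<close> given by recursive generation, having a nonzero coefficient at \<open>x^k\<close>, forces \<open>\<delta> = 0\<close>.
\<close>

hide_const (open) Module.smult

section \<open>Gauss quadrature for truncated moment sequences\<close>

text \<open>A polynomial spanned by the monomials of \<open>M\<close> is linear in y, hence given by
  its restrictions f and g to the two lines. As X^k Y is missing, the admissible pairs are those of
  degree at most k with equal coefficients at x^k. This coupling is the obstacle: positivity of
  \<open>M\<close> yields positivity on a single line only below degree k, and beyond that merely a
  range condition. The freedom in the top moments arises because splitting row i takes both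
  \<open>\<beta> i 0\<close> and \<open>\<beta> i 1\<close>, and for i = 2k the latter lies beyond
  the given degree. The excess \<delta> is handled like a mass at infinity, seen only by the
  coefficient of X^k; this makes \<open>M\<close> and \<open>N\<close> sums of independent rank-one
  forms. After absorption one line carries k + 1 nodes, but interpolation by admissible pairs
  survives, since the other line has at most k nodes; so rank \<open>M_k\<close> still counts the
  atoms. For an arbitrary representing measure a column relation p = 0 means that p vanishes almost
  everywhere, which makes (3) immediate. The implications form the cycle (2), (1), (3), (4), (2);
  the atomic form with excess serves the last two.\<close>

definition riesz :: "(nat \<Rightarrow> real) \<Rightarrow> real poly \<Rightarrow> real" where
  "riesz \<gamma> p = (\<Sum>i\<le>degree p. coeff p i * \<gamma> i)"

lemma riesz_eq_sum: "degree p \<le> n \<Longrightarrow> riesz \<gamma> p = (\<Sum>i\<le>n. coeff p i * \<gamma> i)"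
  unfolding riesz_def by (rule sum.mono_neutral_left) (auto simp: coeff_eq_0)

lemma riesz_0 [simp]: "riesz \<gamma> 0 = 0"
  by (simp add: riesz_def)

lemma riesz_add: "riesz \<gamma> (p + q) = riesz \<gamma> p + riesz \<gamma> q"
proof -
  let ?n = "max (degree p) (degree q)"
  have "degree (p + q) \<le> ?n"
    by (rule degree_add_le_max)
  then show ?thesis
    by (simp add: riesz_eq_sum[of _ ?n] ring_distribs sum.distrib)
qed

lemma riesz_smult: "riesz \<gamma> (smult c p) = c * riesz \<gamma> p"
  using degree_smult_le[of c p]
  by (simp add: riesz_eq_sum[of _ "degree p"] sum_distrib_left mult.assoc)

lemma riesz_diff: "riesz \<gamma> (p - q) = riesz \<gamma> p - riesz \<gamma> q"
  using riesz_add[of \<gamma> p "smult (-1) q"] riesz_smult[of \<gamma> "-1" q] by simp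

lemma riesz_sum: "riesz \<gamma> (\<Sum>x\<in>X. f x) = (\<Sum>x\<in>X. riesz \<gamma> (f x))"
  by (induction X rule: infinite_finite_induct) (auto simp: riesz_add)

lemma riesz_monom: "riesz \<gamma> (monom c n) = c * \<gamma> n"
  by (simp add: riesz_eq_sum[of _ n] degree_monom_le if_distrib[of "\<lambda>x. x * _"] cong: if_cong)

lemma riesz_orthogonal:
  assumes "\<And>i. i \<le> n \<Longrightarrow> riesz \<gamma> (p * monom 1 i) = 0" and "degree u \<le> n"
  shows "riesz \<gamma> (p * u) = 0"
proof -
  have u: "u = (\<Sum>i\<le>n. smult (coeff u i) (monom 1 i))"
    using poly_as_sum_of_monoms'[OF assms(2)] by (simp add: smult_monom)
  have "p * u = (\<Sum>i\<le>n. smult (coeff u i) (p * monom 1 i))"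
    by (subst u) (simp add: sum_distrib_left)
  then show ?thesis
    by (simp add: riesz_sum riesz_smult assms(1))
qed

lemma riesz_fun_upd:
  assumes "degree p \<le> n"
  shows "riesz (\<gamma>(n := t)) p = riesz \<gamma> p + coeff p n * (t - \<gamma> n)"
proof -
  have "riesz (\<gamma>(n := t)) p = (\<Sum>i\<le>n. coeff p i * \<gamma> i + (if i = n then coeff p n * (t - \<gamma> n) else 0))"
    unfolding riesz_eq_sum[OF assms] by (rule sum.cong) (auto simp: algebra_simps)
  then show ?thesis
    by (simp add: riesz_eq_sum[OF assms] sum.distrib)
qed

text \<open>Stands in for Cauchy-Schwarz: expanding a semidefinite form at \<open>u + c * p\<close>
  with p a null vector leaves an expression linear in c, so the mixed term must vanish.\<close>

lemma nonneg_linear_imp_zero: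
  fixes A B :: real
  assumes "\<And>c. 0 \<le> A + c * B"
  shows "B = 0"
proof (rule ccontr)
  assume "B \<noteq> 0"
  have "0 \<le> A + (- (A + 1) / B) * B" by (rule assms)
  also have "\<dots> = -1" using \<open>B \<noteq> 0\<close> by simp
  finally show False by simp
qed

text \<open>Gram-Schmidt, one degree at a time: the remainder \<open>q\<close> of the monomial of
  degree m is orthogonal to everything below and has positive square, so the component of h along it
  can be removed. The induction needs h arbitrary because it projects that monomial as well as h.
  The space is given by vanishing coefficients instead of \<open>degree < m\<close> so that it is
  the zero space for m = 0.\<close>

lemma orthogonal_projection_exists:
  assumes "\<And>f. f \<noteq> 0 \<Longrightarrow> degree f < m \<Longrightarrow> riesz \<gamma> (f * f) > 0"
  shows "\<exists>h'. (\<forall>i\<ge>m. coeff h' i = 0) \<and> (\<forall>u. (\<forall>i\<ge>m. coeff u i = 0) \<longrightarrow> riesz \<gamma> ((h - h') * u) = 0)"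
  using assms
proof (induction m arbitrary: h)
  case 0
  have "riesz \<gamma> (h * u) = 0" if "\<forall>i\<ge>0. coeff u i = 0" for u
  proof -
    have "u = 0" using that by (simp add: poly_eq_iff)
    then show ?thesis by simp
  qed
  then show ?case
    by (intro exI[of _ 0]) auto
next
  case (Suc m)
  have pos: "\<And>f. f \<noteq> 0 \<Longrightarrow> degree f < m \<Longrightarrow> riesz \<gamma> (f * f) > 0"
    using Suc.prems by simp
  obtain q0 where q0: "\<forall>i\<ge>m. coeff q0 i = 0"
    and q0_orth: "\<And>u. \<forall>i\<ge>m. coeff u i = 0 \<Longrightarrow> riesz \<gamma> ((monom 1 m - q0) * u) = 0"
    using Suc.IH[OF pos, of "monom 1 m"] by blast
  obtain h0 where h0: "\<forall>i\<ge>m. coeff h0 i = 0"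
    and h0_orth: "\<And>u. \<forall>i\<ge>m. coeff u i = 0 \<Longrightarrow> riesz \<gamma> ((h - h0) * u) = 0"
    using Suc.IH[OF pos, of h] by blast
  define q where "q = monom 1 m - q0"
  have q_coeff: "coeff q m = 1" "\<And>i. i > m \<Longrightarrow> coeff q i = 0"
    using q0 by (auto simp: q_def)
  have "degree q \<le> m" by (rule degree_le) (simp add: q_coeff)
  moreover have "q \<noteq> 0" using q_coeff(1) by auto
  ultimately have qq: "riesz \<gamma> (q * q) > 0" using Suc.prems[of q] by simp
  define c where "c = riesz \<gamma> ((h - h0) * q) / riesz \<gamma> (q * q)"
  show ?case
  proof (intro exI[of _ "h0 + smult c q"] conjI allI impI)
    fix i assume "i \<ge> Suc m"
    then show "coeff (h0 + smult c q) i = 0" using h0 q_coeff(2)[of i] by simp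
  next
    fix u :: "real poly" assume u: "\<forall>i\<ge>Suc m. coeff u i = 0"
    define d u' where "d = coeff u m" and "u' = u - smult d q"
    have u'0: "\<forall>i\<ge>m. coeff u' i = 0"
    proof (intro allI impI)
      fix i assume "i \<ge> m"
      then show "coeff u' i = 0"
        using u q_coeff by (cases "i = m") (auto simp: u'_def d_def)
    qed
    have "(h - (h0 + smult c q)) * u =
        smult d ((h - h0) * q) + (h - h0) * u' - smult (c * d) (q * q) - smult c (q * u')"
      by (simp add: u'_def algebra_simps smult_add_right smult_diff_right)
    then have "riesz \<gamma> ((h - (h0 + smult c q)) * u) =
        d * riesz \<gamma> ((h - h0) * q) - c * d * riesz \<gamma> (q * q)"
      using h0_orth[OF u'0] q0_orth[OF u'0]
      by (simp only: riesz_add riesz_diff riesz_smult q_def)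
    then show "riesz \<gamma> ((h - (h0 + smult c q)) * u) = 0"
      using qq by (simp add: c_def)
  qed
qed

text \<open>The degree n is separate from m for the sake of two uses: n = m gives the usual
  orthogonal polynomial, and m = k, n = k + 1 asks for exactly those orthogonality relations that
  moments up to 2k can express.\<close>

lemma monic_orthogonal_exists:
  assumes "\<And>f. f \<noteq> 0 \<Longrightarrow> degree f < m \<Longrightarrow> riesz \<gamma> (f * f) > 0" and "m \<le> n"
  obtains P where "degree P = n" "lead_coeff P = 1" "\<And>i. i < m \<Longrightarrow> riesz \<gamma> (P * monom 1 i) = 0"
proof -
  obtain h where h: "\<forall>i\<ge>m. coeff h i = 0"
    and orth: "\<And>u. \<forall>i\<ge>m. coeff u i = 0 \<Longrightarrow> riesz \<gamma> ((monom 1 n - h) * u) = 0"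
    using orthogonal_projection_exists[OF assms(1), of m "monom 1 n"] by blast
  have cn: "coeff (monom 1 n - h) n = 1" using h assms(2) by simp
  moreover have "degree (monom 1 n - h) = n"
  proof (rule antisym)
    show "degree (monom 1 n - h) \<le> n" using h assms(2) by (intro degree_le) auto
    show "n \<le> degree (monom 1 n - h)" using cn by (intro le_degree) simp
  qed
  ultimately show ?thesis
    using orth by (intro that[of "monom 1 n - h"]) auto
qed

section \<open>Real-rootedness of orthogonal polynomials\<close>

lemma prod_linear_factors_dvd:
  fixes P :: "real poly"
  assumes "finite X" and "\<And>x. x \<in> X \<Longrightarrow> poly P x = 0"
  shows "(\<Prod>x\<in>X. [:-x, 1:]) dvd P"
  using assms
proof (induction X rule: finite_induct)
  case (insert a X)
  then obtain Q where Q: "P = (\<Prod>x\<in>X. [:-x, 1:]) * Q" by (auto elim: dvdE)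
  have "poly (\<Prod>x\<in>X. [:-x, 1:]) a \<noteq> 0"
    using insert.hyps by (auto simp: poly_prod)
  moreover have "poly P a = 0" using insert.prems by simp
  ultimately have "poly Q a = 0" by (simp add: Q)
  then have "[:-a, 1:] dvd Q" by (simp add: poly_eq_0_iff_dvd)
  then show ?case
    unfolding Q prod.insert[OF insert.hyps] by (metis dvd_refl mult.commute mult_dvd_mono)
qed simp

lemma degree_prod_linear: "degree (\<Prod>x\<in>X. [:-x, 1::real:]) = card X" if "finite X"
  using that by (induction X rule: finite_induct) (auto simp: degree_mult_eq simp del: mult_pCons_left)

lemma monic_prod_linear: "lead_coeff (\<Prod>x\<in>X. [:-x, 1::real:]) = 1"
  by (simp add: lead_coeff_prod)

text \<open>A non-real root z gives the factor (x - Re z)^2 + (Im z)^2. It is kept as a sum of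
  squares because positivity will be applied to the two squares separately.\<close>

lemma real_poly_complex_root_cases:
  fixes Q :: "real poly"
  assumes "degree Q > 0"
  shows "(\<exists>a. poly Q a = 0) \<or> (\<exists>a b. b \<noteq> 0 \<and> ([:-a, 1:]\<^sup>2 + [:b\<^sup>2:]) dvd Q)"
proof -
  interpret map_poly_comm_ring_hom "complex_of_real" ..
  have "degree (map_poly complex_of_real Q) > 0" using assms by simp
  then obtain z where z: "poly (map_poly complex_of_real Q) z = 0"
    using alg_closed_imp_poly_has_root by blast
  show ?thesis
  proof (cases "Im z = 0")
    case True
    then have "z = complex_of_real (Re z)" by (simp add: complex_eq_iff)
    then have "complex_of_real (poly Q (Re z)) = 0"
      using z by (metis of_real_hom.poly_map_poly)
    then show ?thesis by auto
  next
    case False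
    define D where "D = [:- Re z, 1:]\<^sup>2 + [:(Im z)\<^sup>2:]"
    have D: "D = [:(Re z)\<^sup>2 + (Im z)\<^sup>2, - 2 * Re z, 1:]"
      by (simp add: D_def power2_eq_square)
    have Dz: "poly (map_poly complex_of_real D) z = 0"
      by (simp add: D complex_eq_iff power2_eq_square algebra_simps)
    \<comment> \<open>The remainder is linear with real coefficients and vanishes at the non-real z,
      so it is zero.\<close>
    have "degree (Q mod D) < 2"
      using degree_mod_less[of D Q] by (auto simp: D)
    then obtain c d where R: "Q mod D = [:c, d:]"
      by (metis One_nat_def Suc_1 degree1_coeffs less_2_cases_iff degree_eq_zeroE pCons_0_0)
    have "Q = D * (Q div D) + [:c, d:]" using R by (metis mult_div_mod_eq)
    then have "poly (map_poly complex_of_real (D * (Q div D) + [:c, d:])) z = 0" using z by simp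
    then have "poly (map_poly complex_of_real [:c, d:]) z = 0"
      using Dz by (simp add: hom_add hom_mult)
    then have "c + d * Re z = 0" "d * Im z = 0" by (auto simp: complex_eq_iff Polynomial.map_poly_pCons algebra_simps)
    then have "Q mod D = 0" using False R by simp
    then show ?thesis using False unfolding D_def by (auto simp: mod_eq_0_iff_dvd)
  qed
qed

text \<open>If P = ((x - a)^2 + b^2) Q, then P Q is the square of (x - a) Q plus b^2 times the
  square of Q; the functional is 0 on the left by orthogonality and positive on the right. The case
  b = 0 excludes double roots, so one argument gives real and simple roots. Only orthogonality up to
  degree r - 2 enters, one less than for the usual orthogonal polynomial; this is what admits r = k
  + 1.\<close>

lemma orthogonal_poly_real_rooted:
  assumes deg: "degree P = r" and lead: "lead_coeff P = 1"
    and pos: "\<And>f. f \<noteq> 0 \<Longrightarrow> degree f < r \<Longrightarrow> riesz \<gamma> (f * f) > 0"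
    and orth: "\<And>u. degree u + 2 \<le> r \<Longrightarrow> riesz \<gamma> (P * u) = 0"
  obtains X where "finite X" "card X = r" "P = (\<Prod>x\<in>X. [:-x, 1:])"
proof -
  have "P \<noteq> 0" using lead by auto
  have quad: "\<not> ([:-a, 1:]\<^sup>2 + [:b\<^sup>2:]) dvd P" for a b
  proof
    let ?D = "[:-a, 1:]\<^sup>2 + [:b\<^sup>2:]"
    assume "?D dvd P"
    then obtain Q where Q: "P = ?D * Q" by (rule dvdE)
    have "Q \<noteq> 0" using Q \<open>P \<noteq> 0\<close> by auto
    have D: "?D = [:a\<^sup>2 + b\<^sup>2, - 2 * a, 1:]" by (simp add: power2_eq_square)
    have "degree P = 2 + degree Q"
      unfolding Q D by (subst degree_mult_eq) (use \<open>Q \<noteq> 0\<close> in auto)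
    then have degQ: "degree Q + 2 = r" using deg by simp
    have "P * Q = ([:-a, 1:] * Q) * ([:-a, 1:] * Q) + [:b\<^sup>2:] * (Q * Q)"
      unfolding Q power2_eq_square[of "[:-a, 1:]"] by (simp only: ring_distribs mult_ac)
    then have "P * Q = ([:-a, 1:] * Q) * ([:-a, 1:] * Q) + smult (b\<^sup>2) (Q * Q)"
      by simp
    moreover have "riesz \<gamma> (P * Q) = 0" using orth[of Q] degQ by simp
    ultimately have "riesz \<gamma> (([:-a, 1:] * Q) * ([:-a, 1:] * Q)) + b\<^sup>2 * riesz \<gamma> (Q * Q) = 0"
      by (simp only: riesz_add riesz_smult)
    moreover have "riesz \<gamma> (Q * Q) > 0" using pos[OF \<open>Q \<noteq> 0\<close>] degQ by simp
    moreover have "riesz \<gamma> (([:-a, 1:] * Q) * ([:-a, 1:] * Q)) > 0"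
    proof (rule pos)
      have "degree ([:-a, 1:] * Q) = 1 + degree Q"
        by (subst degree_mult_eq) (use \<open>Q \<noteq> 0\<close> in auto)
      then show "degree ([:-a, 1:] * Q) < r" using degQ by simp
      show "[:-a, 1:] * Q \<noteq> 0" using \<open>Q \<noteq> 0\<close> by (metis mult_eq_0_iff one_neq_zero pCons_eq_0_iff)
    qed
    ultimately show False by (smt (verit) mult_nonneg_nonneg zero_le_power2)
  qed
  define X where "X = {x. poly P x = 0}"
  have fin: "finite X" unfolding X_def by (rule poly_roots_finite[OF \<open>P \<noteq> 0\<close>])
  let ?R = "\<Prod>x\<in>X. [:-x, 1:]"
  have "?R dvd P" by (rule prod_linear_factors_dvd[OF fin]) (simp add: X_def)
  then obtain Q where Q: "P = ?R * Q" by (rule dvdE)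
  have "Q \<noteq> 0" using Q \<open>P \<noteq> 0\<close> by auto
  have "degree Q = 0"
  proof (rule ccontr)
    assume "degree Q \<noteq> 0"
    then consider a where "poly Q a = 0" | a b where "([:-a, 1:]\<^sup>2 + [:b\<^sup>2:]) dvd Q"
      using real_poly_complex_root_cases[of Q] by blast
    then show False
    proof cases
      case (1 a)
      then have "poly P a = 0" by (simp add: Q)
      then have "a \<in> X" by (simp add: X_def)
      then have "[:-a, 1:] dvd ?R" using fin by (intro dvd_prodI)
      moreover have "[:-a, 1:] dvd Q" using 1 by (simp add: poly_eq_0_iff_dvd)
      \<comment> \<open>A double root is the excluded quadratic with b = 0.\<close>
      ultimately have "[:-a, 1:]\<^sup>2 + [:0\<^sup>2:] dvd P"
        unfolding Q by (simp add: power2_eq_square mult_dvd_mono del: mult_pCons_left mult_pCons_right)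
      then show False using quad by blast
    next
      case (2 a b)
      then show False using quad[of a b] unfolding Q by (blast intro: dvd_mult)
    qed
  qed
  then obtain c where c: "Q = [:c:]" by (rule degree_eq_zeroE)
  have "lead_coeff P = lead_coeff ?R * lead_coeff Q" unfolding Q by (rule lead_coeff_mult)
  then have "c = 1" using lead c by (simp only: monic_prod_linear) simp
  then have "P = ?R" using Q c by simp
  then show ?thesis using degree_prod_linear[OF fin] deg fin that by metis
qed

section \<open>Lagrange interpolation and Gauss quadrature\<close>

definition lagrange :: "real set \<Rightarrow> real \<Rightarrow> real poly" where
  "lagrange X a = smult (inverse (\<Prod>b\<in>X - {a}. a - b)) (\<Prod>b\<in>X - {a}. [:-b, 1:])"

lemma poly_lagrange:
  assumes "finite X" "a \<in> X" "b \<in> X"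
  shows "poly (lagrange X a) b = (if a = b then 1 else 0)"
  using assms by (auto simp: lagrange_def poly_prod)

lemma degree_lagrange:
  assumes "finite X" "a \<in> X"
  shows "degree (lagrange X a) = card X - 1"
  using assms by (simp add: lagrange_def degree_prod_linear)

lemma poly_eq_lagrange_sum:
  assumes "finite X" "degree f < card X"
  shows "f = (\<Sum>a\<in>X. smult (poly f a) (lagrange X a))"
proof (rule ccontr)
  define g where "g = f - (\<Sum>a\<in>X. smult (poly f a) (lagrange X a))"
  assume "f \<noteq> (\<Sum>a\<in>X. smult (poly f a) (lagrange X a))"
  then have "g \<noteq> 0" by (simp add: g_def)
  have "degree (\<Sum>a\<in>X. smult (poly f a) (lagrange X a)) \<le> card X - 1"
    using assms(1) by (intro degree_sum_le) (auto intro: order_trans[OF degree_smult_le] simp: degree_lagrange)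
  then have deg: "degree g < card X"
    unfolding g_def using assms(2) by (smt (verit) degree_diff_le One_nat_def Suc_pred le_less_trans less_Suc_eq_le not_gr0 not_less_zero)
  have "poly g b = 0" if "b \<in> X" for b
  proof -
    have "(\<Sum>a\<in>X. poly f a * poly (lagrange X a) b) = (\<Sum>a\<in>X. if a = b then poly f a else 0)"
      using assms(1) that by (intro sum.cong) (auto simp: poly_lagrange)
    then show ?thesis using assms(1) that by (simp add: g_def poly_sum)
  qed
  then have "X \<subseteq> {x. poly g x = 0}" by auto
  then have "card X \<le> card {x. poly g x = 0}"
    using poly_roots_finite[OF \<open>g \<noteq> 0\<close>] by (rule card_mono[rotated])
  also have "\<dots> \<le> degree g" by (rule card_poly_roots_bound[OF \<open>g \<noteq> 0\<close>])
  finally show False using deg by simp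
qed

text \<open>Dividing f by P, the quotient part is killed by orthogonality and the remainder is
  recovered by Lagrange interpolation at the roots. The bound \<open>r \<le> k + 1\<close> covers
  both the flat case, with at most k nodes, and the case with one more node, where an excess is
  absorbed.\<close>

lemma gauss_quadrature:
  assumes deg: "degree P = r" and lead: "lead_coeff P = 1" and r: "r \<le> k + 1"
    and pos: "\<And>f. f \<noteq> 0 \<Longrightarrow> degree f < r \<Longrightarrow> riesz \<gamma> (f * f) > 0"
    and orth: "\<And>i. i + r \<le> 2 * k \<Longrightarrow> riesz \<gamma> (P * monom 1 i) = 0"
  obtains X w where "finite X" "card X = r" "P = (\<Prod>x\<in>X. [:-x, 1:])"
    "\<And>x. x \<in> X \<Longrightarrow> w x > 0" "\<And>i. i \<le> 2 * k \<Longrightarrow> \<gamma> i = (\<Sum>x\<in>X. w x * x ^ i)"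
proof -
  have orth': "riesz \<gamma> (P * u) = 0" if "degree u + r \<le> 2 * k" for u
    by (rule riesz_orthogonal[of "degree u"]) (use that orth in auto)
  obtain X where X: "finite X" "card X = r" and P: "P = (\<Prod>x\<in>X. [:-x, 1:])"
    by (rule orthogonal_poly_real_rooted[OF deg lead pos]) (use orth' r in auto)
  have root: "poly P x = 0" if "x \<in> X" for x
    using that X(1) by (auto simp: P poly_prod)
  have "P \<noteq> 0" using lead by auto
  define w where "w x = riesz \<gamma> (lagrange X x)" for x
  have quad: "riesz \<gamma> f = (\<Sum>x\<in>X. w x * poly f x)" if f: "degree f \<le> 2 * k" for f
  proof -
    have "riesz \<gamma> (P * (f div P)) = 0"
    proof (cases "f div P = 0")
      case False
      have prod_deg: "degree (P * (f div P)) = r + degree (f div P)"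
        using False \<open>P \<noteq> 0\<close> deg by (simp add: degree_mult_eq)
      have "degree (f mod P) < degree (P * (f div P)) \<or> f mod P = 0"
        using degree_mod_less[OF \<open>P \<noteq> 0\<close>, of f] deg prod_deg by auto
      then have "degree (P * (f div P) + f mod P) = degree (P * (f div P))"
        by (metis degree_add_eq_left add_0_right)
      then have "degree f = degree (P * (f div P))"
        by (simp only: mult_div_mod_eq)
      then show ?thesis using f deg by (intro orth') (simp add: prod_deg)
    qed simp
    moreover have "riesz \<gamma> (f mod P) = (\<Sum>x\<in>X. w x * poly f x)"
    proof (cases "r = 0")
      case True
      then have "P = 1" "X = {}" using X P by auto
      then show ?thesis by simp
    next
      case False
      then have "degree (f mod P) < card X"
        using degree_mod_less[OF \<open>P \<noteq> 0\<close>, of f] deg X(2) by auto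
      then have "f mod P = (\<Sum>a\<in>X. smult (poly (f mod P) a) (lagrange X a))"
        by (rule poly_eq_lagrange_sum[OF X(1)])
      then have "riesz \<gamma> (f mod P) = (\<Sum>a\<in>X. poly (f mod P) a * w a)"
        by (metis (no_types, lifting) riesz_smult riesz_sum sum.cong w_def)
      also have "\<dots> = (\<Sum>x\<in>X. w x * poly f x)"
      proof (rule sum.cong[OF refl])
        fix x assume "x \<in> X"
        have "poly f x = poly P x * poly (f div P) x + poly (f mod P) x"
          by (simp only: mult_div_mod_eq flip: poly_add poly_mult)
        then have "poly (f mod P) x = poly f x" using root[OF \<open>x \<in> X\<close>] by simp
        then show "poly (f mod P) x * w x = w x * poly f x" by simp
      qed
      finally show ?thesis .
    qed
    moreover have "riesz \<gamma> f = riesz \<gamma> (P * (f div P)) + riesz \<gamma> (f mod P)"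
      by (simp only: mult_div_mod_eq flip: riesz_add)
    ultimately show ?thesis by simp
  qed
  show ?thesis
  proof (rule that[of X w])
    fix x assume x: "x \<in> X"
    \<comment> \<open>Its square has degree 2 (r - 1), at most 2k, so the formula is exact there; it
      is 1 at x and 0 at the other nodes, and the value is the weight itself.\<close>
    let ?l = "lagrange X x"
    have "card X \<noteq> 0" using X(1) x by auto
    then have degl: "degree ?l < r" "degree (?l * ?l) \<le> 2 * k"
      using degree_lagrange[OF X(1) x] X(2) r degree_mult_le[of ?l ?l] by auto
    have "?l \<noteq> 0" using poly_lagrange[OF X(1) x x] by auto
    then have "0 < riesz \<gamma> (?l * ?l)" using pos degl by blast
    also have "\<dots> = (\<Sum>y\<in>X. if x = y then w y else 0)"
      unfolding quad[OF degl(2)] by (intro sum.cong) (auto simp: poly_lagrange X(1) x)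
    also have "\<dots> = w x" using X(1) x by simp
    finally show "w x > 0" .
  next
    fix i assume "i \<le> 2 * k"
    then show "\<gamma> i = (\<Sum>x\<in>X. w x * x ^ i)"
      using quad[of "monom 1 i"] by (simp add: riesz_monom poly_monom degree_monom_eq)
  qed (use X P in auto)
qed

text \<open>If the form is definite below degree k, the orthogonal polynomial of degree k serves.
  Otherwise P is a monic null vector of least degree r: semidefiniteness makes it orthogonal to all
  degrees below k, and the range condition pushes this up. The product of degree 2k is left out
  because the top moment is still to be chosen.\<close>

lemma flat_orthogonal_poly_exists:
  assumes nonneg: "\<And>f. degree f < k \<Longrightarrow> riesz \<gamma> (f * f) \<ge> 0"
    and range: "\<And>f. degree f < k \<Longrightarrow> riesz \<gamma> (f * f) = 0 \<Longrightarrow> riesz \<gamma> (f * monom 1 k) = 0"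
  obtains r P where "r \<le> k" "degree P = r" "lead_coeff P = 1"
    "\<And>f. f \<noteq> 0 \<Longrightarrow> degree f < r \<Longrightarrow> riesz \<gamma> (f * f) > 0"
    "\<And>m. m + r < 2 * k \<Longrightarrow> riesz \<gamma> (P * monom 1 m) = 0"
proof (cases "\<forall>f. f \<noteq> 0 \<longrightarrow> degree f < k \<longrightarrow> riesz \<gamma> (f * f) > 0")
  case True
  then have pos: "f \<noteq> 0 \<Longrightarrow> degree f < k \<Longrightarrow> riesz \<gamma> (f * f) > 0" for f by blast
  obtain P where "degree P = k" "lead_coeff P = 1" "\<And>i. i < k \<Longrightarrow> riesz \<gamma> (P * monom 1 i) = 0"
    by (rule monic_orthogonal_exists[OF pos order_refl]) auto
  then show ?thesis using True by (intro that[of k P]) auto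
next
  case False
  define R where "R n \<longleftrightarrow> (\<exists>f. f \<noteq> 0 \<and> degree f = n \<and> n < k \<and> riesz \<gamma> (f * f) = 0)" for n
  have "\<exists>n. R n" using False nonneg unfolding R_def by (metis less_eq_real_def)
  define r where "r = (LEAST n. R n)"
  have "R r" unfolding r_def using \<open>\<exists>n. R n\<close> by (rule LeastI_ex)
  then obtain f where f: "f \<noteq> 0" "degree f = r" "r < k" "riesz \<gamma> (f * f) = 0" by (auto simp: R_def)
  have pos: "riesz \<gamma> (g * g) > 0" if "g \<noteq> 0" "degree g < r" for g
  proof -
    have "\<not> R (degree g)" using that(2) unfolding r_def by (rule not_less_Least)
    then show ?thesis using that f(3) nonneg[of g] by (force simp: R_def)
  qed
  define P where "P = smult (inverse (lead_coeff f)) f"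
  have P: "degree P = r" "lead_coeff P = 1" "riesz \<gamma> (P * P) = 0"
    using f leading_coeff_neq_0[OF f(1)] by (simp_all add: P_def riesz_smult)
  have orth_lt: "riesz \<gamma> (P * u) = 0" if u: "degree u < k" for u
  proof -
    have "0 \<le> riesz \<gamma> (u * u) + c * (2 * riesz \<gamma> (P * u))" for c
    proof -
      have "degree (u + smult c P) < k"
        using u P(1) f(3) by (intro degree_add_less) (auto intro: le_less_trans[OF degree_smult_le])
      from nonneg[OF this] have "0 \<le> riesz \<gamma> ((u + smult c P) * (u + smult c P))" .
      also have "(u + smult c P) * (u + smult c P) = u * u + smult c (P * u) + smult c (P * u) + smult (c * c) (P * P)"
        by (simp add: algebra_simps)
      finally show ?thesis unfolding riesz_add riesz_smult P(3) by (simp add: algebra_simps)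
    qed
    then have "2 * riesz \<gamma> (P * u) = 0" by (rule nonneg_linear_imp_zero)
    then show ?thesis by simp
  qed
  have orth: "riesz \<gamma> (P * monom 1 m) = 0" if "m + r < 2 * k" for m
    using that
  proof (induction m rule: less_induct)
    case (less m)
    show ?case
    proof (cases "m < k")
      case True
      then show ?thesis by (intro orth_lt) (simp add: degree_monom_eq)
    next
      case False
      \<comment> \<open>Here i + r < k, so \<open>2 * i + r < m\<close>: the square of
        \<open>P * monom 1 i\<close> involves only cases already settled, and its vanishing passes
        to the product with x^k by the range condition.\<close>
      define i where "i = m - k"
      have m: "m = i + k" using False by (simp add: i_def)
      let ?f = "P * monom 1 i"
      have deg: "degree ?f < k"
        using degree_mult_le[of P "monom 1 i"] less.prems m P(1) by (simp add: degree_monom_eq)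
      have "riesz \<gamma> (P * (monom 1 i * ?f)) = 0"
      proof (rule riesz_orthogonal)
        show "degree (monom 1 i * ?f) \<le> 2 * i + r"
          using degree_mult_le[of P "monom 1 i"] degree_mult_le[of "monom 1 i" ?f] P(1)
          by (simp add: degree_monom_eq)
        show "riesz \<gamma> (P * monom 1 j) = 0" if "j \<le> 2 * i + r" for j
          using that less.prems m by (intro less.IH) auto
      qed
      then have "riesz \<gamma> (?f * monom 1 k) = 0"
        by (intro range[OF deg]) (simp add: mult_ac)
      then show ?thesis by (simp add: m mult.assoc mult_monom)
    qed
  qed
  show ?thesis using f(3) P pos orth by (intro that[of r P]) auto
qed

text \<open>The top moment \<open>\<gamma> (2 * k)\<close> does not occur in the hypotheses; \<open>t\<close> is its smallest admissible value.\<close>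

lemma truncated_hamburger_flat:
  assumes nonneg: "\<And>f. degree f < k \<Longrightarrow> riesz \<gamma> (f * f) \<ge> 0"
    and range: "\<And>f. degree f < k \<Longrightarrow> riesz \<gamma> (f * f) = 0 \<Longrightarrow> riesz \<gamma> (f * monom 1 k) = 0"
  obtains t X w where "finite X" "card X \<le> k" "\<And>x. x \<in> X \<Longrightarrow> w x > 0"
    "\<And>i. i \<le> 2 * k \<Longrightarrow> (\<gamma>(2 * k := t)) i = (\<Sum>x\<in>X. w x * x ^ i)"
proof (rule flat_orthogonal_poly_exists[OF nonneg range])
  fix r P
  assume r: "r \<le> k" and P: "degree P = r" "lead_coeff P = 1"
    and pos: "\<And>f. f \<noteq> 0 \<Longrightarrow> degree f < r \<Longrightarrow> riesz \<gamma> (f * f) > 0"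
    and orth: "\<And>m. m + r < 2 * k \<Longrightarrow> riesz \<gamma> (P * monom 1 m) = 0"
  \<comment> \<open>The top moment is chosen to give the last missing orthogonality relation; P
    being monic, \<open>P * monom 1 (2 * k - r)\<close> has coefficient 1 at degree 2k, so t is
    found by one subtraction.\<close>
  define t where "t = \<gamma> (2 * k) - riesz \<gamma> (P * monom 1 (2 * k - r))"
  have upd: "riesz (\<gamma>(2 * k := t)) p = riesz \<gamma> p" if "degree p < 2 * k" for p
    using that by (subst riesz_fun_upd) (auto simp: coeff_eq_0)
  have degP: "degree (P * monom 1 i) \<le> i + r" for i
    using degree_mult_le[of P "monom 1 i"] P(1) by (simp add: degree_monom_eq)
  show ?thesis
  proof (rule gauss_quadrature[OF P, of k "\<gamma>(2 * k := t)"])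
    show "r \<le> k + 1" using r by simp
    show "riesz (\<gamma>(2 * k := t)) (f * f) > 0" if "f \<noteq> 0" "degree f < r" for f
      using pos[OF that] that(2) r degree_mult_le[of f f] by (subst upd) auto
    show "riesz (\<gamma>(2 * k := t)) (P * monom 1 i) = 0" if "i + r \<le> 2 * k" for i
    proof (cases "i + r < 2 * k")
      case True
      then show ?thesis using orth degP[of i] by (subst upd) auto
    next
      case False
      then have i: "i = 2 * k - r" using that by simp
      have "coeff (P * monom 1 i) (2 * k) = 1"
        using P r by (simp add: i mult.commute[of P] coeff_monom_mult)
      then show ?thesis
        using degP[of i] that by (subst riesz_fun_upd) (auto simp: t_def i)
    qed
    fix X w
    assume "finite X" "card X = r" "\<And>x. x \<in> X \<Longrightarrow> w x > 0"
      "\<And>i. i \<le> 2 * k \<Longrightarrow> (\<gamma>(2 * k := t)) i = (\<Sum>x\<in>X. w x * x ^ i)"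
    then show ?thesis using r by (intro that[of X w t]) auto
  qed
qed auto

section \<open>Quadratic forms and ranks of moment matrices\<close>

text \<open>Coefficients are indexed by monomials instead of positions. The order of a monomial list
  then disappears, and matrices on different sets are compared by extending coefficients by
  zero.\<close>

definition moment_form :: "(nat \<Rightarrow> nat \<Rightarrow> real) \<Rightarrow> (nat \<times> nat) set \<Rightarrow> (nat \<times> nat \<Rightarrow> real) \<Rightarrow> (nat \<times> nat \<Rightarrow> real) \<Rightarrow> real" where
  "moment_form \<beta> S c d = (\<Sum>m\<in>S. \<Sum>n\<in>S. c m * d n * \<beta> (fst m + fst n) (snd m + snd n))"

lemma sum_nth_distinct:
  assumes "distinct xs"
  shows "(\<Sum>i<length xs. f (xs ! i)) = sum f (set xs)"
  using sum.reindex_bij_betw[OF bij_betw_nth[OF assms refl refl], of f] .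

lemma moment_submatrix_mult_vec:
  assumes "distinct ms" "r < length ms"
  shows "(moment_submatrix \<beta> ms *\<^sub>v Matrix.vec (length ms) (\<lambda>i. c (ms ! i))) $ r =
    (\<Sum>n\<in>set ms. c n * \<beta> (fst (ms ! r) + fst n) (snd (ms ! r) + snd n))"
proof -
  have "(moment_submatrix \<beta> ms *\<^sub>v Matrix.vec (length ms) (\<lambda>i. c (ms ! i))) $ r =
     (\<Sum>i<length ms. c (ms ! i) * \<beta> (fst (ms ! r) + fst (ms ! i)) (snd (ms ! r) + snd (ms ! i)))"
    using assms(2) by (simp add: moment_submatrix_def scalar_prod_def atLeast0LessThan mult.commute)
  then show ?thesis
    by (simp add: sum_nth_distinct[OF assms(1), of "\<lambda>n. c n * \<beta> (fst (ms ! r) + fst n) (snd (ms ! r) + snd n)"])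
qed

lemma scalar_prod_moment_submatrix:
  assumes "distinct ms"
  shows "Matrix.vec (length ms) (\<lambda>i. c (ms ! i)) \<bullet> (moment_submatrix \<beta> ms *\<^sub>v Matrix.vec (length ms) (\<lambda>i. d (ms ! i)))
    = moment_form \<beta> (set ms) c d"
proof -
  have "Matrix.vec (length ms) (\<lambda>i. c (ms ! i)) \<bullet> (moment_submatrix \<beta> ms *\<^sub>v Matrix.vec (length ms) (\<lambda>i. d (ms ! i)))
     = (\<Sum>i<length ms. c (ms ! i) * (moment_submatrix \<beta> ms *\<^sub>v Matrix.vec (length ms) (\<lambda>i. d (ms ! i))) $ i)"
    unfolding scalar_prod_def
    by (rule sum.cong) (auto simp: moment_submatrix_def)
  also have "\<dots> = (\<Sum>i<length ms. \<Sum>n\<in>set ms. c (ms ! i) * d n * \<beta> (fst (ms ! i) + fst n) (snd (ms ! i) + snd n))"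
    by (rule sum.cong[OF refl], subst moment_submatrix_mult_vec[OF assms])
       (auto simp: sum_distrib_left mult.assoc)
  finally show ?thesis
    by (simp add: moment_form_def
        sum_nth_distinct[OF assms, of "\<lambda>m. \<Sum>n\<in>set ms. c m * d n * \<beta> (fst m + fst n) (snd m + snd n)"])
qed

lemma vec_eq_coefficients:
  assumes "distinct ms" "v \<in> carrier_vec (length ms)"
  obtains c where "v = Matrix.vec (length ms) (\<lambda>i. c (ms ! i))"
proof
  let ?c = "\<lambda>m. v $ the_inv_into {..<length ms} ((!) ms) m"
  show "v = Matrix.vec (length ms) (\<lambda>i. ?c (ms ! i))"
  proof (rule eq_vecI)
    fix i assume "i < dim_vec (Matrix.vec (length ms) (\<lambda>i. ?c (ms ! i)))"
    then show "v $ i = Matrix.vec (length ms) (\<lambda>i. ?c (ms ! i)) $ i"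
      using the_inv_into_f_f[OF inj_on_nth[OF assms(1)], of "{..<length ms}" i] by simp
  qed (use assms(2) in auto)
qed

lemma psd_moment_submatrix_iff:
  assumes "distinct ms"
  shows "psd (moment_submatrix \<beta> ms) \<longleftrightarrow> (\<forall>c. moment_form \<beta> (set ms) c c \<ge> 0)"
proof -
  have "square_mat (moment_submatrix \<beta> ms)" "transpose_mat (moment_submatrix \<beta> ms) = moment_submatrix \<beta> ms"
    by (auto simp: moment_submatrix_def add.commute intro!: eq_matI)
  moreover have "(\<forall>v \<in> carrier_vec (length ms). v \<bullet> (moment_submatrix \<beta> ms *\<^sub>v v) \<ge> 0) \<longleftrightarrow>
      (\<forall>c. moment_form \<beta> (set ms) c c \<ge> 0)" (is "?L \<longleftrightarrow> ?R")
  proof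
    assume ?L
    then show ?R by (metis scalar_prod_moment_submatrix[OF assms] vec_carrier)
  next
    assume ?R
    then show ?L by (metis scalar_prod_moment_submatrix[OF assms] vec_eq_coefficients[OF assms])
  qed
  ultimately show ?thesis
    by (simp add: psd_def moment_submatrix_def)
qed

section \<open>The monomials of the full moment matrix and its column relations\<close>

lemma set_monomials_upto: "set (monomials_upto k) = {(i, j). i + j \<le> k}"
proof -
  have "set (monomials_upto k) = (\<Union>d\<in>{..<k + 1}. (\<lambda>j. (d - j, j)) ` {..<d + 1})"
    by (simp add: monomials_upto_def atLeast0LessThan del: upt_Suc)
  also have "\<dots> = {(i, j). i + j \<le> k}"
  proof (intro subset_antisym subsetI)
    fix m assume "m \<in> {(i, j). i + j \<le> k}"
    then obtain i j where m: "m = (i, j)" "i + j \<le> k" by auto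
    then have "m \<in> (\<lambda>j'. (i + j - j', j')) ` {..<i + j + 1}" by (intro image_eqI[of _ _ j]) auto
    then show "m \<in> (\<Union>d\<in>{..<k + 1}. (\<lambda>j. (d - j, j)) ` {..<d + 1})" using m(2) by (intro UN_I[of "i + j"]) auto
  qed auto
  finally show ?thesis .
qed

lemma distinct_monomials_upto: "distinct (monomials_upto k)"
proof (induction k)
  case (Suc k)
  have "monomials_upto (Suc k) = monomials_upto k @ map (\<lambda>j. (Suc k - j, j)) [0..<Suc k + 1]"
    by (simp add: monomials_upto_def)
  moreover have "distinct (map (\<lambda>j. (Suc k - j, j)) [0..<Suc k + 1])"
    by (simp add: distinct_map inj_on_def del: upt_Suc)
  moreover have "set (monomials_upto k) \<inter> set (map (\<lambda>j. (Suc k - j, j)) [0..<Suc k + 1]) = {}"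
    by (auto simp: set_monomials_upto simp del: upt_Suc)
  ultimately show ?case using Suc.IH by (simp only: distinct_append)
qed (simp add: monomials_upto_def)

lemma finite_monomials_upto: "finite {(i, j). i + j \<le> (k::nat)}"
  unfolding set_monomials_upto[symmetric] by simp

lemma column_relation_iff:
  "column_relation k \<beta> p \<longleftrightarrow> total_degree_le k p \<and>
     (\<forall>i j. i + j \<le> k \<longrightarrow> (\<Sum>(i', j')\<in>{(i, j). i + j \<le> k}. bicoeff p i' j' * \<beta> (i + i') (j + j')) = 0)"
proof -
  let ?ms = "monomials_upto k"
  let ?c = "\<lambda>(i, j). bicoeff p i j"
  have v: "vec_of_list (map ?c ?ms) = Matrix.vec (length ?ms) (\<lambda>i. ?c (?ms ! i))"
    by (intro eq_vecI) (auto simp: vec_of_list_index)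
  have "column_eval k \<beta> p = 0\<^sub>v (dim_row (moment_matrix k \<beta>)) \<longleftrightarrow>
     (\<forall>r<length ?ms. (moment_submatrix \<beta> ?ms *\<^sub>v Matrix.vec (length ?ms) (\<lambda>i. ?c (?ms ! i))) $ r = 0)"
    unfolding column_eval_def v moment_matrix_def
    by (auto simp: vec_eq_iff moment_submatrix_def)
  also have "\<dots> \<longleftrightarrow> (\<forall>r<length ?ms. (\<lambda>m. \<Sum>n\<in>set ?ms. ?c n * \<beta> (fst m + fst n) (snd m + snd n)) (?ms ! r) = 0)"
    using moment_submatrix_mult_vec[OF distinct_monomials_upto, where c="?c"] by auto
  also have "\<dots> \<longleftrightarrow> (\<forall>m\<in>set ?ms. (\<Sum>n\<in>set ?ms. ?c n * \<beta> (fst m + fst n) (snd m + snd n)) = 0)"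
    by (simp only: all_set_conv_all_nth)
  finally show ?thesis
    unfolding column_relation_def set_monomials_upto by (simp add: case_prod_beta)
qed

text \<open>A = B C, where B has the vectors \<phi> as columns and C is its transpose scaled by d.
  The dual vectors e yield a left inverse \<open>F\<close> of B, so its columns are independent, and
  a right inverse \<open>E\<close> of C, so A and B have the same column space.\<close>

lemma rank_sum_rank_one:
  fixes A :: "real mat"
  assumes I: "finite I" and d: "\<And>j. j \<in> I \<Longrightarrow> d j \<noteq> 0"
    and A: "A = mat n n (\<lambda>(a, b). \<Sum>j\<in>I. d j * \<phi> j a * \<phi> j b)"
    and dual: "\<And>i j. i \<in> I \<Longrightarrow> j \<in> I \<Longrightarrow> (\<Sum>a<n. \<phi> i a * e j a) = (if i = j then 1 else 0)"
  shows "vec_space.rank n A = card I"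
proof -
  interpret vec_space "TYPE(real)" n .
  obtain h where h: "bij_betw h {..<card I} I"
    using ex_bij_betw_nat_finite[OF I] by (auto simp: atLeast0LessThan)
  define r where "r = card I"
  have hI: "h j \<in> I" if "j < r" for j
    using h that by (auto simp: bij_betw_def r_def)
  have h_inj: "h i = h j \<longleftrightarrow> i = j" if "i < r" "j < r" for i j
    using h that by (auto simp: bij_betw_def r_def inj_on_def)
  define B where "B = mat n r (\<lambda>(a, j). \<phi> (h j) a)"
  define C where "C = mat r n (\<lambda>(j, b). d (h j) * \<phi> (h j) b)"
  define E where "E = mat n r (\<lambda>(a, j). e (h j) a / d (h j))"
  define F where "F = mat r n (\<lambda>(j, a). e (h j) a)"
  have BC: "B \<in> carrier_mat n r" "C \<in> carrier_mat r n" "E \<in> carrier_mat n r" "F \<in> carrier_mat r n"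
    by (auto simp: B_def C_def E_def F_def)
  have ABC: "A = B * C"
  proof (rule eq_matI)
    fix a b assume "a < dim_row (B * C)" "b < dim_col (B * C)"
    then have ab: "a < n" "b < n" by (auto simp: B_def C_def)
    have "(\<Sum>j\<in>I. d j * \<phi> j a * \<phi> j b) = (\<Sum>j<r. d (h j) * \<phi> (h j) a * \<phi> (h j) b)"
      unfolding r_def
      by (rule sum.reindex_bij_betw[OF h, of "\<lambda>j. d j * \<phi> j a * \<phi> j b", symmetric])
    then show "A $$ (a, b) = (B * C) $$ (a, b)"
      using ab by (simp add: A B_def C_def scalar_prod_def atLeast0LessThan mult_ac)
  qed (auto simp: A B_def C_def)
  have CE: "C * E = 1\<^sub>m r"
  proof (rule eq_matI)
    fix i j assume "i < dim_row (1\<^sub>m r)" "j < dim_col (1\<^sub>m r)"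
    then have ij: "i < r" "j < r" by auto
    have "(C * E) $$ (i, j) = (\<Sum>a<n. d (h i) / d (h j) * (\<phi> (h i) a * e (h j) a))"
      using ij by (simp add: C_def E_def scalar_prod_def atLeast0LessThan mult_ac)
    also have "\<dots> = d (h i) / d (h j) * (if h i = h j then 1 else 0)"
      by (simp only: sum_distrib_left[symmetric] dual[OF hI[OF ij(1)] hI[OF ij(2)]])
    also have "\<dots> = 1\<^sub>m r $$ (i, j)" using ij h_inj d[OF hI[OF ij(1)]] by auto
    finally show "(C * E) $$ (i, j) = 1\<^sub>m r $$ (i, j)" .
  qed (use BC in auto)
  have FB: "F * B = 1\<^sub>m r"
  proof (rule eq_matI)
    fix i j assume "i < dim_row (1\<^sub>m r)" "j < dim_col (1\<^sub>m r)"
    then have ij: "i < r" "j < r" by auto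
    have "(F * B) $$ (i, j) = (\<Sum>a<n. \<phi> (h j) a * e (h i) a)"
      using ij by (simp add: F_def B_def scalar_prod_def atLeast0LessThan mult_ac)
    also have "\<dots> = 1\<^sub>m r $$ (i, j)" using ij h_inj dual[OF hI[OF ij(2)] hI[OF ij(1)]] by auto
    finally show "(F * B) $$ (i, j) = 1\<^sub>m r $$ (i, j)" .
  qed (use BC in auto)
  have A_carrier: "A \<in> carrier_mat n n" by (simp add: A)
  have AE: "A * E = B"
    unfolding ABC using BC CE by (simp add: assoc_mult_mat[of B n r C n E r])
  have "rank A = rank B"
  proof -
    have "col_space A = col_space B"
      unfolding col_space_eq[OF A_carrier] col_space_eq[OF BC(1)]
    proof safe
      fix x :: "real Matrix.vec" assume "x \<in> carrier_vec (dim_col A)"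
      then have "A *\<^sub>v x = B *\<^sub>v (C *\<^sub>v x)" "C *\<^sub>v x \<in> carrier_vec (dim_col B)"
        using BC A_carrier unfolding ABC by (auto simp: assoc_mult_mat_vec[of B n r C n])
      then show "\<exists>y\<in>carrier_vec (dim_col B). B *\<^sub>v y = A *\<^sub>v x" by auto
    next
      fix x :: "real Matrix.vec" assume "x \<in> carrier_vec (dim_col B)"
      then have "B *\<^sub>v x = A *\<^sub>v (E *\<^sub>v x)" "E *\<^sub>v x \<in> carrier_vec (dim_col A)"
        using BC A_carrier unfolding AE[symmetric] by (auto simp: assoc_mult_mat_vec[of A n n E r])
      then show "\<exists>y\<in>carrier_vec (dim_col A). A *\<^sub>v y = B *\<^sub>v x" by auto
    qed (use A_carrier BC in auto)
    then show ?thesis by (simp add: rank_def col_space_def)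
  qed
  also have "rank B = r"
  proof (rule lin_indpt_full_rank[OF BC(1)])
    show dist: "distinct (cols B)"
    proof (unfold distinct_conv_nth, intro allI impI)
      fix i j assume ij: "i < length (cols B)" "j < length (cols B)" "i \<noteq> j"
      then have ij': "i < r" "j < r" using BC by auto
      show "cols B ! i \<noteq> cols B ! j"
      proof
        assume "cols B ! i = cols B ! j"
        then have "col (F * B) i = col (F * B) j"
          using ij ij' col_mult2[OF BC(4) BC(1)] by simp
        then have "col (1\<^sub>m r) i $ i = (col (1\<^sub>m r) j $ i :: real)" unfolding FB by simp
        then show False using ij' ij(3) by simp
      qed
    qed
    show "lin_indpt (set (cols B))"
    proof
      assume "lin_dep (set (cols B))"
      then obtain v where v: "v \<in> carrier_vec r" "v \<noteq> 0\<^sub>v r" "B *\<^sub>v v = 0\<^sub>v n"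
        using lin_depE[OF BC(1) _ dist] by blast
      have "v = (F * B) *\<^sub>v v" using v(1) by (simp add: FB)
      also have "\<dots> = F *\<^sub>v (B *\<^sub>v v)" using BC v(1) by (intro assoc_mult_mat_vec) auto
      also have "\<dots> = 0\<^sub>v r" using BC v(3) by (auto intro!: eq_vecI)
      finally show False using v(2) by simp
    qed
  qed
  finally show ?thesis by (simp add: r_def)
qed

section \<open>Atomic sequences and their functionals\<close>

text \<open>The functionals on coefficient vectors by which an atomic sequence is represented: evaluation at
  a point, and (as \<open>None\<close>) the coefficient of \<open>X^k\<close>.\<close>

definition monomial_functional :: "nat \<Rightarrow> (real \<times> real) option \<Rightarrow> nat \<times> nat \<Rightarrow> real" where
  "monomial_functional k j m =
     (case j of None \<Rightarrow> if m = (k, 0) then 1 else 0 | Some z \<Rightarrow> fst z ^ fst m * snd z ^ snd m)"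

definition coeff_functional :: "nat \<Rightarrow> (nat \<times> nat) set \<Rightarrow> (real \<times> real) option \<Rightarrow> (nat \<times> nat \<Rightarrow> real) \<Rightarrow> real" where
  "coeff_functional k S j c = (\<Sum>m\<in>S. c m * monomial_functional k j m)"

text \<open>A sum over atoms plus an excess in a single moment: within the degree bound
  \<open>i = 2 * k\<close> forces j = 0, so only \<open>\<beta> (2 * k) 0\<close> is affected. For
  \<delta> = 0 this is a genuine atomic representation.\<close>

definition atomic_rep ::
    "nat \<Rightarrow> (nat \<Rightarrow> nat \<Rightarrow> real) \<Rightarrow> (real \<times> real) set \<Rightarrow> (real \<times> real \<Rightarrow> real) \<Rightarrow> real \<Rightarrow> bool" where
  "atomic_rep k \<beta> Z \<rho> \<delta> \<longleftrightarrow> finite Z \<and> (\<forall>z\<in>Z. \<rho> z > 0) \<and> \<delta> \<ge> 0 \<and>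
     (\<forall>i j. i + j \<le> 2 * k \<longrightarrow>
        \<beta> i j = (\<Sum>z\<in>Z. \<rho> z * (fst z ^ i * snd z ^ j)) + (if i = 2 * k then \<delta> else 0))"

text \<open>Two monomials of degree at most k have product X^(2k) only if both are X^k. So the
  excess is one more rank-one term, belonging to \<open>None\<close>.\<close>

lemma atomic_rep_kernel:
  assumes "atomic_rep k \<beta> Z \<rho> \<delta>" "fst m + snd m \<le> k" "fst n + snd n \<le> k"
  shows "\<beta> (fst m + fst n) (snd m + snd n) =
    (\<Sum>z\<in>Z. \<rho> z * monomial_functional k (Some z) m * monomial_functional k (Some z) n) +
    \<delta> * monomial_functional k None m * monomial_functional k None n"
proof -
  have "fst m + fst n = 2 * k \<longleftrightarrow> m = (k, 0) \<and> n = (k, 0)"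
    using assms(2,3) by (cases m, cases n) auto
  then show ?thesis
    using assms unfolding atomic_rep_def by (simp add: monomial_functional_def power_add mult_ac)
qed

lemma moment_form_atomic_rep:
  assumes rep: "atomic_rep k \<beta> Z \<rho> \<delta>" and S: "\<And>m. m \<in> S \<Longrightarrow> fst m + snd m \<le> k"
  shows "moment_form \<beta> S c d =
    (\<Sum>z\<in>Z. \<rho> z * coeff_functional k S (Some z) c * coeff_functional k S (Some z) d) +
    \<delta> * coeff_functional k S None c * coeff_functional k S None d"
proof -
  let ?F = "monomial_functional k"
  have "moment_form \<beta> S c d = (\<Sum>m\<in>S. \<Sum>n\<in>S. c m * d n *
      ((\<Sum>z\<in>Z. \<rho> z * ?F (Some z) m * ?F (Some z) n) + \<delta> * ?F None m * ?F None n))"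
    unfolding moment_form_def by (intro sum.cong refl) (simp add: atomic_rep_kernel[OF rep S S])
  also have "\<dots> = (\<Sum>m\<in>S. \<Sum>n\<in>S. \<Sum>z\<in>Z. \<rho> z * (c m * ?F (Some z) m) * (d n * ?F (Some z) n)) +
      (\<Sum>m\<in>S. \<Sum>n\<in>S. \<delta> * (c m * ?F None m) * (d n * ?F None n))"
    by (simp add: ring_distribs sum.distrib sum_distrib_left mult_ac)
  also have "(\<Sum>m\<in>S. \<Sum>n\<in>S. \<Sum>z\<in>Z. \<rho> z * (c m * ?F (Some z) m) * (d n * ?F (Some z) n)) =
      (\<Sum>m\<in>S. \<Sum>z\<in>Z. \<Sum>n\<in>S. \<rho> z * (c m * ?F (Some z) m) * (d n * ?F (Some z) n))"
    by (intro sum.cong refl sum.swap)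
  also have "\<dots> = (\<Sum>z\<in>Z. \<Sum>m\<in>S. \<Sum>n\<in>S. \<rho> z * (c m * ?F (Some z) m) * (d n * ?F (Some z) n))"
    by (rule sum.swap)
  finally have "moment_form \<beta> S c d =
      (\<Sum>z\<in>Z. \<Sum>m\<in>S. \<Sum>n\<in>S. \<rho> z * (c m * ?F (Some z) m) * (d n * ?F (Some z) n)) +
      (\<Sum>m\<in>S. \<Sum>n\<in>S. \<delta> * (c m * ?F None m) * (d n * ?F None n))" .
  moreover have eq: "(\<Sum>m\<in>S. \<Sum>n\<in>S. r * u m * v n) = r * sum u S * sum v S" for r and u v :: "nat \<times> nat \<Rightarrow> real"
  proof -
    have "r * sum u S * sum v S = r * (\<Sum>m\<in>S. \<Sum>n\<in>S. u m * v n)"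
      by (simp only: mult.assoc sum_product)
    then show ?thesis by (simp add: sum_distrib_left mult.assoc)
  qed
  ultimately show ?thesis by (simp only: coeff_functional_def eq)
qed

text \<open>The coefficients of the polynomial \<open>p\<close>, linear in \<open>y\<close>, with \<open>p(x, \<alpha>1) = f\<close> and \<open>p(x, \<alpha>2) = g\<close>.\<close>

definition line_pair :: "real \<Rightarrow> real \<Rightarrow> real poly \<Rightarrow> real poly \<Rightarrow> nat \<times> nat \<Rightarrow> real" where
  "line_pair \<alpha>1 \<alpha>2 f g m =
     (if snd m = 0 then (\<alpha>2 * coeff f (fst m) - \<alpha>1 * coeff g (fst m)) / (\<alpha>2 - \<alpha>1)
      else if snd m = 1 then (coeff g (fst m) - coeff f (fst m)) / (\<alpha>2 - \<alpha>1) else 0)"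

text \<open>Guarantees that S contains every monomial with a nonzero coefficient in
  \<open>line_pair\<close>. A monomial with y is demanded only where f and g differ; equal
  coefficients at x^k thus allow X^k Y to be absent.\<close>

definition pair_supported :: "(nat \<times> nat) set \<Rightarrow> real poly \<Rightarrow> real poly \<Rightarrow> bool" where
  "pair_supported S f g \<longleftrightarrow> finite S \<and> (\<forall>i. coeff f i \<noteq> 0 \<or> coeff g i \<noteq> 0 \<longrightarrow> (i, 0) \<in> S) \<and>
     (\<forall>i. coeff f i \<noteq> coeff g i \<longrightarrow> (i, 1) \<in> S)"

text \<open>Substituting \<alpha> for y gives the affine interpolation between f at
  \<open>\<alpha>1\<close> and g at \<open>\<alpha>2\<close>. Leaving \<alpha> free treats both
  lines at once.\<close>

lemma sum_line_pair:
  assumes "\<alpha>1 \<noteq> \<alpha>2" "pair_supported S f g"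
  shows "(\<Sum>m\<in>S. monom (line_pair \<alpha>1 \<alpha>2 f g m * \<alpha> ^ snd m) (fst m)) =
    smult ((\<alpha>2 - \<alpha>) / (\<alpha>2 - \<alpha>1)) f + smult ((\<alpha> - \<alpha>1) / (\<alpha>2 - \<alpha>1)) g"
proof (rule poly_eqI)
  fix i
  let ?c = "line_pair \<alpha>1 \<alpha>2 f g"
  have S: "finite S" using assms(2) by (simp add: pair_supported_def)
  have "coeff (\<Sum>m\<in>S. monom (?c m * \<alpha> ^ snd m) (fst m)) i = (\<Sum>m\<in>S. if fst m = i then ?c m * \<alpha> ^ snd m else 0)"
    by (simp add: coeff_sum)
  also have "\<dots> = (\<Sum>m\<in>{(i, 0), (i, 1)}. ?c m * \<alpha> ^ snd m)"
  proof (rule sum.mono_neutral_cong[OF _ S])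
    show "?c m * \<alpha> ^ snd m = 0" if "m \<in> {(i, 0), (i, 1)} - S" for m
    proof -
      have "(i, 0) \<notin> S \<Longrightarrow> coeff f i = 0 \<and> coeff g i = 0" "(i, 1) \<notin> S \<Longrightarrow> coeff f i = coeff g i"
        using assms(2) unfolding pair_supported_def by blast+
      then show ?thesis using that by (auto simp: line_pair_def)
    qed
    show "(if fst m = i then ?c m * \<alpha> ^ snd m else 0) = 0" if "m \<in> S - {(i, 0), (i, 1)}" for m
      using that by (cases m) (auto simp: line_pair_def)
  qed auto
  also have "\<dots> = coeff (smult ((\<alpha>2 - \<alpha>) / (\<alpha>2 - \<alpha>1)) f + smult ((\<alpha> - \<alpha>1) / (\<alpha>2 - \<alpha>1)) g) i"
    using assms(1) by (simp add: line_pair_def divide_simps) (simp add: algebra_simps)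
  finally show "coeff (\<Sum>m\<in>S. monom (?c m * \<alpha> ^ snd m) (fst m)) i =
      coeff (smult ((\<alpha>2 - \<alpha>) / (\<alpha>2 - \<alpha>1)) f + smult ((\<alpha> - \<alpha>1) / (\<alpha>2 - \<alpha>1)) g) i" .
qed

lemma coeff_functional_line_pair:
  assumes "\<alpha>1 \<noteq> \<alpha>2" "pair_supported S f g"
  shows "coeff_functional k S (Some (x, \<alpha>1)) (line_pair \<alpha>1 \<alpha>2 f g) = poly f x"
    and "coeff_functional k S (Some (x, \<alpha>2)) (line_pair \<alpha>1 \<alpha>2 f g) = poly g x"
proof -
  have "coeff_functional k S (Some (x, \<alpha>)) (line_pair \<alpha>1 \<alpha>2 f g) =
      poly (\<Sum>m\<in>S. monom (line_pair \<alpha>1 \<alpha>2 f g m * \<alpha> ^ snd m) (fst m)) x" for \<alpha>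
    by (simp add: coeff_functional_def monomial_functional_def poly_sum poly_monom mult_ac)
  then show "coeff_functional k S (Some (x, \<alpha>1)) (line_pair \<alpha>1 \<alpha>2 f g) = poly f x"
    and "coeff_functional k S (Some (x, \<alpha>2)) (line_pair \<alpha>1 \<alpha>2 f g) = poly g x"
    using assms(1) unfolding sum_line_pair[OF assms] by simp_all
qed

lemma coeff_functional_None_line_pair:
  assumes "\<alpha>1 \<noteq> \<alpha>2" "pair_supported S f g" "coeff f k = coeff g k"
  shows "coeff_functional k S None (line_pair \<alpha>1 \<alpha>2 f g) = coeff f k"
proof -
  let ?c = "line_pair \<alpha>1 \<alpha>2 f g"
  have "finite S" and out: "(k, 0) \<notin> S \<Longrightarrow> coeff f k = 0"
    using assms(2) by (auto simp: pair_supported_def)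
  have "coeff_functional k S None ?c = (\<Sum>m\<in>S. if m = (k, 0) then ?c m else 0)"
    unfolding coeff_functional_def monomial_functional_def by (intro sum.cong) auto
  also have "\<dots> = (if (k, 0) \<in> S then ?c (k, 0) else 0)"
    by (rule sum.delta[OF \<open>finite S\<close>])
  also have "?c (k, 0) = (\<alpha>2 - \<alpha>1) * coeff f k / (\<alpha>2 - \<alpha>1)"
    using assms(3) by (simp add: line_pair_def left_diff_distrib)
  also have "\<dots> = coeff f k" using assms(1) by simp
  finally show ?thesis using out by simp
qed

text \<open>The factor x^(n - card X) raises the degree to exactly n when there are fewer nodes.
  Additional zeros at 0 do no harm; what counts is being monic of degree n and vanishing on
  X.\<close>

definition vanishing_poly :: "nat \<Rightarrow> real set \<Rightarrow> real poly" where
  "vanishing_poly n X = monom 1 (n - card X) * (\<Prod>x\<in>X. [:-x, 1:])"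

lemma vanishing_poly:
  assumes "finite X" "card X \<le> n"
  shows "degree (vanishing_poly n X) = n" "coeff (vanishing_poly n X) n = 1"
    "\<And>x. x \<in> X \<Longrightarrow> poly (vanishing_poly n X) x = 0"
proof -
  have 1: "lead_coeff (vanishing_poly n X) = 1"
    unfolding vanishing_poly_def lead_coeff_mult monic_prod_linear by (simp add: degree_monom_eq)
  have "(\<Prod>x\<in>X. [:-x, 1::real:]) \<noteq> 0" using monic_prod_linear[of X] by auto
  then show 2: "degree (vanishing_poly n X) = n"
    using assms unfolding vanishing_poly_def
    by (subst degree_mult_eq) (auto simp: degree_monom_eq degree_prod_linear)
  show "coeff (vanishing_poly n X) n = 1" using 1 2 by simp
  show "poly (vanishing_poly n X) x = 0" if "x \<in> X" for x
    using that assms(1) by (auto simp: vanishing_poly_def poly_prod)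
qed

lemma riesz_atomic:
  assumes "\<And>i. i \<le> n \<Longrightarrow> \<gamma> i = (\<Sum>x\<in>X. w x * x ^ i)" "degree p \<le> n"
  shows "riesz \<gamma> p = (\<Sum>x\<in>X. w x * poly p x)"
proof -
  have "riesz \<gamma> p = (\<Sum>i\<le>n. \<Sum>x\<in>X. coeff p i * (w x * x ^ i))"
    using assms by (simp add: riesz_eq_sum sum_distrib_left)
  also have "\<dots> = (\<Sum>x\<in>X. \<Sum>i\<le>n. coeff p i * (w x * x ^ i))"
    by (rule sum.swap)
  also have "\<dots> = (\<Sum>x\<in>X. w x * (\<Sum>i\<le>n. coeff p i * x ^ i))"
    by (simp add: sum_distrib_left mult_ac)
  finally have "riesz \<gamma> p = (\<Sum>x\<in>X. w x * (\<Sum>i\<le>n. coeff p i * x ^ i))" .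
  moreover have eval: "(\<Sum>i\<le>n. coeff p i * x ^ i) = poly p x" for x
    using riesz_eq_sum[OF assms(2), of "\<lambda>i. x ^ i"] by (simp add: riesz_def poly_altdef)
  ultimately show ?thesis by (simp only: eval)
qed

section \<open>Sequences on two parallel lines\<close>

text \<open>With \<open>u m = c m * \<alpha> ^ snd m\<close> the polynomial \<open>F\<close> is the
  restriction of the polynomial with coefficients c to the line y = \<alpha>.\<close>

lemma riesz_lift:
  fixes u :: "nat \<times> nat \<Rightarrow> real" and S :: "(nat \<times> nat) set"
  defines "F \<equiv> (\<Sum>m\<in>S. monom (u m) (fst m))"
  shows "riesz \<gamma> (F * F) = (\<Sum>m\<in>S. \<Sum>n\<in>S. u m * u n * \<gamma> (fst m + fst n))"
  unfolding F_def by (simp add: sum_product riesz_sum mult_monom riesz_monom)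

definition mon_M :: "nat \<Rightarrow> (nat \<times> nat) list" where
  "mon_M k = map (\<lambda>i. (i, 0)) [0..<k + 1] @ map (\<lambda>i. (i, 1)) [0..<k]"

definition mon_N :: "nat \<Rightarrow> (nat \<times> nat) list" where
  "mon_N k = map (\<lambda>i. (i, 0)) [0..<k] @ map (\<lambda>i. (i, 1)) [0..<k]"

lemma distinct_mon: "distinct (mon_M k)" "distinct (mon_N k)"
  by (auto simp: mon_M_def mon_N_def distinct_map inj_on_def simp del: upt_Suc)

lemma set_mon:
  "set (mon_M k) = {..k} \<times> {0} \<union> {..<k} \<times> {1}" "set (mon_N k) = {..<k} \<times> {0} \<union> {..<k} \<times> {1}"
  by (auto simp: mon_M_def mon_N_def simp del: upt_Suc)

lemma pair_supported_M:
  assumes "degree f \<le> k" "degree g \<le> k" "coeff f k = coeff g k" "finite S" "set (mon_M k) \<subseteq> S"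
  shows "pair_supported S f g"
proof -
  have "i \<le> k" if "coeff f i \<noteq> 0 \<or> coeff g i \<noteq> 0" for i
    using that assms(1,2) le_degree le_trans by blast
  moreover have "i < k" if "coeff f i \<noteq> coeff g i" for i
    using that assms(3) calculation[of i] by (cases "i = k") auto
  ultimately show ?thesis
    using assms(4,5) unfolding pair_supported_def set_mon by blast
qed

lemma pair_supported_N:
  assumes "degree f < k" "degree g < k"
  shows "pair_supported (set (mon_N k)) f g"
proof -
  have "i < k" if "coeff f i \<noteq> 0 \<or> coeff g i \<noteq> 0" for i
    using that assms le_degree le_less_trans by blast
  then show ?thesis unfolding pair_supported_def set_mon by force
qed

text \<open>For fixed i this is a linear recurrence in j with characteristic roots
  \<open>\<alpha>1\<close> and \<open>\<alpha>2\<close>, so two initial values determine both parts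
  as long as i < 2k.\<close>

lemma recurrence_decomposition:
  fixes \<beta> :: "nat \<Rightarrow> nat \<Rightarrow> real"
  assumes "\<alpha>1 \<noteq> \<alpha>2" "k \<ge> 1"
    and rec: "\<And>i j. i + j \<le> 2 * k - 2 \<Longrightarrow> \<beta> i (j + 2) = (\<alpha>1 + \<alpha>2) * \<beta> i (j + 1) - \<alpha>1 * \<alpha>2 * \<beta> i j"
  obtains a b where "\<And>i j. i + j \<le> 2 * k \<Longrightarrow> \<beta> i j = \<alpha>1 ^ j * a i + \<alpha>2 ^ j * b i"
proof -
  \<comment> \<open>For i = 2k only the sum a + b is prescribed. Giving everything to b is an
    arbitrary choice, which the later replacement of both top moments makes irrelevant.\<close>
  define a where "a i = (if i < 2 * k then (\<alpha>2 * \<beta> i 0 - \<beta> i 1) / (\<alpha>2 - \<alpha>1) else 0)" for i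
  define b where "b i = (if i < 2 * k then (\<beta> i 1 - \<alpha>1 * \<beta> i 0) / (\<alpha>2 - \<alpha>1) else \<beta> i 0)" for i
  have base: "\<beta> i 0 = a i + b i" "\<beta> i 1 = \<alpha>1 * a i + \<alpha>2 * b i" if "i < 2 * k" for i
  proof -
    have "a i + b i = (\<alpha>2 - \<alpha>1) * \<beta> i 0 / (\<alpha>2 - \<alpha>1)"
      using that by (simp add: a_def b_def left_diff_distrib flip: add_divide_distrib)
    then show "\<beta> i 0 = a i + b i" using assms(1) by simp
    have "\<alpha>1 * a i + \<alpha>2 * b i = (\<alpha>2 - \<alpha>1) * \<beta> i 1 / (\<alpha>2 - \<alpha>1)"
      using that by (simp add: a_def b_def algebra_simps flip: add_divide_distrib)
    then show "\<beta> i 1 = \<alpha>1 * a i + \<alpha>2 * b i" using assms(1) by simp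
  qed
  have "\<beta> i j = \<alpha>1 ^ j * a i + \<alpha>2 ^ j * b i" if "i + j \<le> 2 * k" for i j
    using that
  proof (induction j rule: less_induct)
    case (less j)
    show ?case
    proof (cases "j < 2")
      case True
      show ?thesis
      proof (cases "i < 2 * k")
        case i: True
        from \<open>j < 2\<close> consider "j = 0" | "j = 1" by linarith
        then show ?thesis by cases (use base[OF i] in simp_all)
      next
        case False
        then have "i = 2 * k" "j = 0" using less.prems by auto
        then show ?thesis by (simp add: a_def b_def)
      qed
    next
      case False
      define j' where "j' = j - 2"
      have 4: "j = j' + 2" using False by (simp add: j'_def)
      have "\<beta> i j = (\<alpha>1 + \<alpha>2) * \<beta> i (j' + 1) - \<alpha>1 * \<alpha>2 * \<beta> i j'"
        using rec[of i j'] less.prems by (simp add: 4)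
      also have "\<beta> i (j' + 1) = \<alpha>1 ^ (j' + 1) * a i + \<alpha>2 ^ (j' + 1) * b i"
        using less.prems by (intro less.IH) (auto simp: 4)
      also have "\<beta> i j' = \<alpha>1 ^ j' * a i + \<alpha>2 ^ j' * b i"
        using less.prems by (intro less.IH) (auto simp: 4)
      finally show ?thesis by (simp add: 4 algebra_simps)
    qed
  qed
  then show ?thesis by (rule that)
qed

text \<open>The form splits along the lines because each part of the sequence sees only the
  restriction to its own line. The condition on the coefficients at x^k expresses that X^k Y is not
  among the monomials of \<open>M\<close>.\<close>

lemma moment_form_decomposition:
  assumes "\<And>i j. i + j \<le> 2 * k \<Longrightarrow> \<beta> i j = \<alpha>1 ^ j * a i + \<alpha>2 ^ j * b i"
    and "\<alpha>1 \<noteq> \<alpha>2" "degree f \<le> k" "degree g \<le> k" "coeff f k = coeff g k"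
  shows "moment_form \<beta> (set (mon_M k)) (line_pair \<alpha>1 \<alpha>2 f g) (line_pair \<alpha>1 \<alpha>2 f g) = riesz a (f * f) + riesz b (g * g)"
proof -
  let ?S = "set (mon_M k)" and ?c = "line_pair \<alpha>1 \<alpha>2 f g"
  have supp: "pair_supported ?S f g"
    by (rule pair_supported_M) (use assms in auto)
  have F: "(\<Sum>m\<in>?S. monom (?c m * \<alpha>1 ^ snd m) (fst m)) = f"
    and G: "(\<Sum>m\<in>?S. monom (?c m * \<alpha>2 ^ snd m) (fst m)) = g"
    using assms(2) by (simp_all add: sum_line_pair[OF assms(2) supp])
  have "moment_form \<beta> ?S ?c ?c = (\<Sum>m\<in>?S. \<Sum>n\<in>?S. ?c m * ?c n *
      (\<alpha>1 ^ (snd m + snd n) * a (fst m + fst n) + \<alpha>2 ^ (snd m + snd n) * b (fst m + fst n)))"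
    unfolding moment_form_def
    by (intro sum.cong refl arg_cong2[where f = "(*)"] assms(1)) (auto simp: set_mon)
  also have "\<dots> = (\<Sum>m\<in>?S. \<Sum>n\<in>?S. ?c m * \<alpha>1 ^ snd m * (?c n * \<alpha>1 ^ snd n) * a (fst m + fst n)) +
      (\<Sum>m\<in>?S. \<Sum>n\<in>?S. ?c m * \<alpha>2 ^ snd m * (?c n * \<alpha>2 ^ snd n) * b (fst m + fst n))"
    by (simp add: ring_distribs sum.distrib power_add mult_ac)
  also have "\<dots> = riesz a (f * f) + riesz b (g * g)"
    using riesz_lift[of a "\<lambda>m. ?c m * \<alpha>1 ^ snd m" ?S] riesz_lift[of b "\<lambda>m. ?c m * \<alpha>2 ^ snd m" ?S]
    unfolding F G by simp
  finally show ?thesis .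
qed

text \<open>The admissible pair (x^k, x^k) is perturbed by c f on the first line only; f has degree
  below k, so the top coefficients stay equal. The second summand does not depend on c, which leaves
  an expression linear in c.\<close>

lemma psd_pair_range:
  assumes "\<And>f g. degree f \<le> k \<Longrightarrow> degree g \<le> k \<Longrightarrow> coeff f k = coeff g k \<Longrightarrow>
      0 \<le> riesz a (f * f) + riesz b (g * g)"
    and "degree f < k" "riesz a (f * f) = 0"
  shows "riesz a (f * monom 1 k) = 0"
proof -
  let ?x = "monom (1::real) k"
  have "0 \<le> (riesz a (?x * ?x) + riesz b (?x * ?x)) + c * (2 * riesz a (f * ?x))" for c
  proof -
    have "0 \<le> riesz a ((?x + smult c f) * (?x + smult c f)) + riesz b (?x * ?x)"
    proof (rule assms(1))
      show "degree (?x + smult c f) \<le> k"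
        using assms(2) by (intro degree_add_le) (auto simp: degree_monom_eq intro: order_trans[OF degree_smult_le])
    qed (use assms(2) in \<open>auto simp: degree_monom_eq coeff_eq_0\<close>)
    also have "(?x + smult c f) * (?x + smult c f) =
        ?x * ?x + smult c (f * ?x) + smult c (f * ?x) + smult (c * c) (f * f)"
      by (simp add: algebra_simps)
    finally show ?thesis unfolding riesz_add riesz_smult assms(3) by (simp add: algebra_simps)
  qed
  then have "2 * riesz a (f * ?x) = 0" by (rule nonneg_linear_imp_zero)
  then show ?thesis by simp
qed

section \<open>The atomic form of a sequence on two lines\<close>

definition line_section :: "real \<Rightarrow> (real \<times> real) set \<Rightarrow> real set" where
  "line_section \<alpha> Z = {x. (x, \<alpha>) \<in> Z}"

lemma mat_M_eq: "mat_M k \<beta> = moment_submatrix \<beta> (mon_M k)"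
  by (simp add: mat_M_def mon_M_def)

lemma mat_N_eq: "mat_N k \<beta> = moment_submatrix \<beta> (mon_N k)"
  by (simp add: mat_N_def mon_N_def)

lemma finite_line_section: "finite Z \<Longrightarrow> finite (line_section \<alpha> Z)"
  by (rule finite_subset[of _ "fst ` Z"]) (force simp: line_section_def)+

lemma sum_horizontal_line: "sum h (X \<times> {\<alpha>}) = (\<Sum>x\<in>X. h (x, \<alpha>))"
proof -
  have "X \<times> {\<alpha>} = (\<lambda>x. (x, \<alpha>)) ` X" by auto
  then show ?thesis by (simp add: sum.reindex inj_on_def)
qed

lemma sum_two_lines:
  assumes "finite X1" "finite X2" "\<alpha>1 \<noteq> \<alpha>2"
  shows "sum h (X1 \<times> {\<alpha>1} \<union> X2 \<times> {\<alpha>2}) = (\<Sum>x\<in>X1. h (x, \<alpha>1)) + (\<Sum>x\<in>X2. h (x, \<alpha>2))"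
  using assms by (subst sum.union_disjoint) (auto simp: sum_horizontal_line)

lemma line_section_decomposition:
  "Z \<subseteq> UNIV \<times> {\<alpha>1, \<alpha>2} \<Longrightarrow> line_section \<alpha>1 Z \<times> {\<alpha>1} \<union> line_section \<alpha>2 Z \<times> {\<alpha>2} = Z"
  by (auto simp: line_section_def)

lemma two_line_structure:
  assumes ne: "\<alpha>1 \<noteq> \<alpha>2" and k: "k \<ge> 1" and psd: "psd (mat_M k \<beta>)"
    and rec: "\<And>i j. i + j \<le> 2 * k - 2 \<Longrightarrow> \<beta> i (j + 2) = (\<alpha>1 + \<alpha>2) * \<beta> i (j + 1) - \<alpha>1 * \<alpha>2 * \<beta> i j"
  obtains Z \<rho> \<delta> where "atomic_rep k \<beta> Z \<rho> \<delta>" "Z \<subseteq> UNIV \<times> {\<alpha>1, \<alpha>2}"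
    "card (line_section \<alpha>1 Z) \<le> k" "card (line_section \<alpha>2 Z) \<le> k"
proof (rule recurrence_decomposition[OF ne k rec])
  fix a b
  assume dec: "\<And>i j. i + j \<le> 2 * k \<Longrightarrow> \<beta> i j = \<alpha>1 ^ j * a i + \<alpha>2 ^ j * b i"
  have pos: "0 \<le> riesz a (f * f) + riesz b (g * g)"
    if "degree f \<le> k" "degree g \<le> k" "coeff f k = coeff g k" for f g
  proof -
    have "0 \<le> moment_form \<beta> (set (mon_M k)) (line_pair \<alpha>1 \<alpha>2 f g) (line_pair \<alpha>1 \<alpha>2 f g)"
      using psd unfolding mat_M_eq psd_moment_submatrix_iff[OF distinct_mon(1)] by blast
    also have "\<dots> = riesz a (f * f) + riesz b (g * g)"
      by (rule moment_form_decomposition[OF _ ne that]) (rule dec)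
    finally show ?thesis .
  qed
  have pos': "0 \<le> riesz b (f * f) + riesz a (g * g)"
    if "degree f \<le> k" "degree g \<le> k" "coeff f k = coeff g k" for f g
    using pos[of g f] that by simp
  \<comment> \<open>Below degree k the pairs (f, 0) and (0, f) are admissible, so each line is
    positive by itself.\<close>
  have pos_a: "riesz a (f * f) \<ge> 0" and pos_b: "riesz b (f * f) \<ge> 0" if "degree f < k" for f
    using pos[of f 0] pos[of 0 f] that by (auto simp: coeff_eq_0)
  show ?thesis
  proof (rule truncated_hamburger_flat[OF pos_a psd_pair_range[OF pos]])
    fix ta X1 w1
    assume X1: "finite X1" "card X1 \<le> k" and w1: "\<And>x. x \<in> X1 \<Longrightarrow> w1 x > 0"
      and a: "\<And>i. i \<le> 2 * k \<Longrightarrow> (a(2 * k := ta)) i = (\<Sum>x\<in>X1. w1 x * x ^ i)"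
    show ?thesis
    proof (rule truncated_hamburger_flat[OF pos_b psd_pair_range[OF pos']])
      fix tb X2 w2
      assume X2: "finite X2" "card X2 \<le> k" and w2: "\<And>x. x \<in> X2 \<Longrightarrow> w2 x > 0"
        and b: "\<And>i. i \<le> 2 * k \<Longrightarrow> (b(2 * k := tb)) i = (\<Sum>x\<in>X2. w2 x * x ^ i)"
      define \<delta> where "\<delta> = (a (2 * k) - ta) + (b (2 * k) - tb)"
      \<comment> \<open>The square vanishes at all nodes and is monic of degree 2k, so the
        functional sees only the change of the top moment.\<close>
      have excess: "riesz \<gamma> (vanishing_poly k X * vanishing_poly k X) = \<gamma> (2 * k) - t"
        if X: "finite X" "card X \<le> k" and \<gamma>: "\<And>i. i \<le> 2 * k \<Longrightarrow> (\<gamma>(2 * k := t)) i = (\<Sum>x\<in>X. w x * x ^ i)"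
        for \<gamma> t X w
      proof -
        let ?v = "vanishing_poly k X"
        have deg: "degree (?v * ?v) \<le> 2 * k" using degree_mult_le[of ?v ?v] by (simp add: vanishing_poly[OF X])
        have "coeff (?v * ?v) (2 * k) = 1"
          using coeff_mult_degree_sum[of ?v ?v] by (simp add: vanishing_poly[OF X] mult_2)
        moreover have "riesz (\<gamma>(2 * k := t)) (?v * ?v) = (\<Sum>x\<in>X. w x * poly (?v * ?v) x)"
          by (rule riesz_atomic[OF _ deg]) (rule \<gamma>)
        ultimately show ?thesis
          using riesz_fun_upd[OF deg, of \<gamma> t] by (simp add: vanishing_poly(3)[OF X])
      qed
      \<comment> \<open>Both vanishing polynomials are monic of degree k and hence form an
        admissible pair; the value of the form at it is \<delta>. The arbitrary distribution of
        \<open>\<beta> (2 * k) 0\<close> cancels in the sum.\<close>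
      have "\<delta> \<ge> 0"
        using pos[of "vanishing_poly k X1" "vanishing_poly k X2"] excess[OF X1 a] excess[OF X2 b]
        by (simp add: \<delta>_def vanishing_poly[OF X1] vanishing_poly[OF X2])
      define \<rho> where "\<rho> z = (if snd z = \<alpha>1 then w1 (fst z) else w2 (fst z))" for z :: "real \<times> real"
      define Z where "Z = X1 \<times> {\<alpha>1} \<union> X2 \<times> {\<alpha>2}"
      have sections: "line_section \<alpha>1 Z = X1" "line_section \<alpha>2 Z = X2"
        using ne by (auto simp: Z_def line_section_def)
      have sum_Z: "(\<Sum>z\<in>Z. \<rho> z * (fst z ^ i * snd z ^ j)) =
          (\<Sum>x\<in>X1. w1 x * x ^ i) * \<alpha>1 ^ j + (\<Sum>x\<in>X2. w2 x * x ^ i) * \<alpha>2 ^ j" for i j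
        using ne by (simp add: Z_def sum_two_lines[OF X1(1) X2(1) ne] \<rho>_def sum_distrib_right mult.assoc)
      have "atomic_rep k \<beta> Z \<rho> \<delta>"
        unfolding atomic_rep_def
      proof (intro conjI allI impI ballI)
        show "finite Z" using X1 X2 by (simp add: Z_def)
        show "\<rho> z > 0" if "z \<in> Z" for z using that w1 w2 ne by (auto simp: Z_def \<rho>_def)
        fix i j assume ij: "i + j \<le> 2 * k"
        show "\<beta> i j = (\<Sum>z\<in>Z. \<rho> z * (fst z ^ i * snd z ^ j)) + (if i = 2 * k then \<delta> else 0)"
          using a[of i] b[of i] ij unfolding sum_Z dec[OF ij] by (cases "i = 2 * k") (auto simp: \<delta>_def)
      qed fact
      then show ?thesis
        by (rule that) (use X1 X2 sections in \<open>auto simp: Z_def\<close>)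
    qed auto
  qed auto
qed auto

text \<open>\<open>I\<close> lists the rank-one terms: one for each atom, and one for the excess
  only if it is nonzero and X^k is among the monomials, as otherwise its term is the zero matrix.
  Coefficient vectors dual to these functionals certify their independence.\<close>

lemma rank_moment_submatrix:
  assumes ms: "distinct ms" "\<And>m. m \<in> set ms \<Longrightarrow> fst m + snd m \<le> k"
    and rep: "atomic_rep k \<beta> Z \<rho> \<delta>"
    and I: "I = Some ` Z \<union> (if \<delta> \<noteq> 0 \<and> (k, 0) \<in> set ms then {None} else {})"
    and dual: "\<And>i j. i \<in> I \<Longrightarrow> j \<in> I \<Longrightarrow> coeff_functional k (set ms) i (e j) = (if i = j then 1 else 0)"
  shows "mat_rank (moment_submatrix \<beta> ms) = card Z + (if \<delta> \<noteq> 0 \<and> (k, 0) \<in> set ms then 1 else 0)"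
proof -
  let ?n = "length ms" and ?top = "\<delta> \<noteq> 0 \<and> (k, 0) \<in> set ms"
  have Z: "finite Z" "\<And>z. z \<in> Z \<Longrightarrow> \<rho> z > 0" using rep by (auto simp: atomic_rep_def)
  define d where "d j = (case j of None \<Rightarrow> \<delta> | Some z \<Rightarrow> \<rho> z)" for j
  define \<phi> where "\<phi> j r = monomial_functional k j (ms ! r)" for j r
  have sum_I: "(\<Sum>j\<in>I. h j) = (\<Sum>z\<in>Z. h (Some z)) + (if ?top then h None else 0)" for h :: "(real \<times> real) option \<Rightarrow> real"
  proof -
    have "(\<Sum>j\<in>I. h j) = (\<Sum>j\<in>Some ` Z. h j) + (\<Sum>j\<in>(if ?top then {None} else {}). h j)"
      unfolding I using Z(1) by (intro sum.union_disjoint) auto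
    then show ?thesis by (simp add: sum.reindex)
  qed
  have "vec_space.rank ?n (moment_submatrix \<beta> ms) = card I"
  proof (rule rank_sum_rank_one)
    show "finite I" using Z(1) by (simp add: I)
    show "d j \<noteq> 0" if "j \<in> I" for j using that by (auto simp: I d_def split: if_splits dest!: Z(2))
    have "monomial_functional k None (ms ! r) = 0" if "r < ?n" "(k, 0) \<notin> set ms" for r
    proof -
      have "ms ! r \<noteq> (k, 0)" using nth_mem[OF that(1)] that(2) by metis
      then show ?thesis by (simp add: monomial_functional_def)
    qed
    then show "moment_submatrix \<beta> ms = mat ?n ?n (\<lambda>(r, c). \<Sum>j\<in>I. d j * \<phi> j r * \<phi> j c)"
      by (intro eq_matI) (auto simp: moment_submatrix_def sum_I atomic_rep_kernel[OF rep ms(2) ms(2)] d_def \<phi>_def)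
    fix i j assume ij: "i \<in> I" "j \<in> I"
    have "(\<Sum>r<?n. \<phi> i r * e j (ms ! r)) = coeff_functional k (set ms) i (e j)"
      unfolding coeff_functional_def \<phi>_def
      using sum_nth_distinct[OF ms(1), of "\<lambda>m. e j m * monomial_functional k i m"] by (simp add: mult.commute)
    then show "(\<Sum>r<?n. \<phi> i r * e j (ms ! r)) = (if i = j then 1 else 0)" using dual[OF ij] by simp
  qed
  moreover have "card I = card Z + (if ?top then 1 else 0)"
    using Z(1) unfolding I by (subst card_Un_disjoint) (auto simp: card_image)
  ultimately show ?thesis by (simp add: moment_submatrix_def)
qed

text \<open>With k + 1 nodes on the second line a Lagrange polynomial there has degree k, and its
  partner must share its top coefficient. A multiple of the monic polynomial of degree k vanishing
  on the first section does this, since that section has at most k points. An atom on the first line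
  needs only degree below k and the partner 0.\<close>

lemma two_line_interpolation:
  assumes Z: "finite Z" "Z \<subseteq> UNIV \<times> {\<alpha>1, \<alpha>2}" and ne: "\<alpha>1 \<noteq> \<alpha>2"
    and card: "card (line_section \<alpha>1 Z) \<le> k" "card (line_section \<alpha>2 Z) \<le> k + 1" and z: "z \<in> Z"
  obtains f g where "degree f \<le> k" "degree g \<le> k" "coeff f k = coeff g k"
    "\<And>x. (x, \<alpha>1) \<in> Z \<Longrightarrow> poly f x = (if (x, \<alpha>1) = z then 1 else 0)"
    "\<And>x. (x, \<alpha>2) \<in> Z \<Longrightarrow> poly g x = (if (x, \<alpha>2) = z then 1 else 0)"
    "card (line_section \<alpha>2 Z) \<le> k \<Longrightarrow> degree f < k \<and> degree g < k"
proof -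
  let ?X1 = "line_section \<alpha>1 Z" and ?X2 = "line_section \<alpha>2 Z"
  have fin: "finite ?X1" "finite ?X2" using finite_line_section[OF Z(1)] by auto
  from z Z(2) consider a where "z = (a, \<alpha>1)" "a \<in> ?X1" | b where "z = (b, \<alpha>2)" "b \<in> ?X2"
    by (cases z) (auto simp: line_section_def)
  then show ?thesis
  proof cases
    case (1 a)
    let ?f = "lagrange ?X1 a"
    have "card ?X1 \<noteq> 0" using fin 1 by auto
    then have "degree ?f < k" using degree_lagrange[OF fin(1) 1(2)] card(1) by simp
    then show ?thesis
      using 1 ne fin
      by (intro that[of ?f 0]) (auto simp: coeff_eq_0 poly_lagrange line_section_def)
  next
    case (2 b)
    let ?g = "lagrange ?X2 b"
    let ?f = "smult (coeff ?g k) (vanishing_poly k ?X1)"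
    have "card ?X2 \<noteq> 0" using fin 2 by auto
    then have "degree ?g \<le> k" "card ?X2 \<le> k \<Longrightarrow> degree ?g < k"
      using degree_lagrange[OF fin(2) 2(2)] card(2) by auto
    moreover have "degree ?f < k" if "degree ?g < k"
      using that by (simp add: coeff_eq_0)
    moreover have "degree ?f \<le> k"
      using degree_smult_le[of "coeff ?g k" "vanishing_poly k ?X1"] by (simp add: vanishing_poly fin card)
    ultimately show ?thesis
      using 2 ne fin card(1)
      by (intro that[of ?f ?g]) (auto simp: vanishing_poly poly_lagrange line_section_def)
  qed
qed

text \<open>The interpolating pairs use only monomials of \<open>M\<close>, so their coefficient
  vectors remain dual on every larger set of monomials. This transfers the count of atoms to the
  full moment matrix.\<close>

lemma rank_atomic_rep:
  assumes rep: "atomic_rep k \<beta> Z \<rho> 0" and ne: "\<alpha>1 \<noteq> \<alpha>2"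
    and Z: "Z \<subseteq> UNIV \<times> {\<alpha>1, \<alpha>2}" "card (line_section \<alpha>1 Z) \<le> k" "card (line_section \<alpha>2 Z) \<le> k + 1"
    and ms: "distinct ms" "\<And>m. m \<in> set ms \<Longrightarrow> fst m + snd m \<le> k" "set (mon_M k) \<subseteq> set ms"
  shows "mat_rank (moment_submatrix \<beta> ms) = card Z"
proof -
  have fin: "finite Z" using rep by (simp add: atomic_rep_def)
  have "\<exists>e. \<forall>z'\<in>Z. coeff_functional k (set ms) (Some z') e = (if z' = z then 1 else 0)" if z: "z \<in> Z" for z
  proof (rule two_line_interpolation[OF fin Z(1) ne Z(2,3) z])
    fix f g
    assume fg: "degree f \<le> k" "degree g \<le> k" "coeff f k = coeff g k"
      and val: "\<And>x. (x, \<alpha>1) \<in> Z \<Longrightarrow> poly f x = (if (x, \<alpha>1) = z then 1 else 0)"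
       "\<And>x. (x, \<alpha>2) \<in> Z \<Longrightarrow> poly g x = (if (x, \<alpha>2) = z then 1 else 0)"
    have supp: "pair_supported (set ms) f g" using pair_supported_M[OF fg _ ms(3)] by simp
    show ?thesis
      using Z(1) by (intro exI[of _ "line_pair \<alpha>1 \<alpha>2 f g"])
        (auto simp: coeff_functional_line_pair[OF ne supp] val)
  qed
  then obtain e where e: "\<And>z z'. z \<in> Z \<Longrightarrow> z' \<in> Z \<Longrightarrow>
      coeff_functional k (set ms) (Some z') (e z) = (if z' = z then 1 else 0)"
    by metis
  have "mat_rank (moment_submatrix \<beta> ms) = card Z + (if (0::real) \<noteq> 0 \<and> (k, 0) \<in> set ms then 1 else 0)"
    by (rule rank_moment_submatrix[OF ms(1,2) rep refl, where e = "\<lambda>j. e (the j)"]) (auto simp: e split: if_splits)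
  then show ?thesis by simp
qed

text \<open>With at most k nodes on each line the interpolating pairs have degree below k: they fit
  into \<open>N\<close> and are not seen by the functional \<open>None\<close>, so one family of
  dual vectors serves both matrices.\<close>

lemma rank_M_N_atomic_rep:
  assumes rep: "atomic_rep k \<beta> Z \<rho> \<delta>" and ne: "\<alpha>1 \<noteq> \<alpha>2"
    and Z: "Z \<subseteq> UNIV \<times> {\<alpha>1, \<alpha>2}" "card (line_section \<alpha>1 Z) \<le> k" "card (line_section \<alpha>2 Z) \<le> k"
  shows "mat_rank (mat_N k \<beta>) = card Z" "mat_rank (mat_M k \<beta>) = card Z + (if \<delta> = 0 then 0 else 1)"
proof -
  have fin: "finite Z" using rep by (simp add: atomic_rep_def)
  have card': "card (line_section \<alpha>2 Z) \<le> k + 1" using Z(3) by simp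
  have sec: "finite (line_section \<alpha>1 Z)" "finite (line_section \<alpha>2 Z)"
    using finite_line_section[OF fin] by auto
  let ?M = "set (mon_M k)" and ?N = "set (mon_N k)"
  define dual where "dual z c \<longleftrightarrow> coeff_functional k ?M None c = 0 \<and> (\<forall>z'\<in>Z.
      coeff_functional k ?M (Some z') c = (if z' = z then 1 else 0) \<and>
      coeff_functional k ?N (Some z') c = (if z' = z then 1 else 0))" for z c
  have dual_exists: "\<exists>e. dual z e" if z: "z \<in> Z" for z
  proof (rule two_line_interpolation[OF fin Z(1) ne Z(2) card' z])
    fix f g
    assume val: "\<And>x. (x, \<alpha>1) \<in> Z \<Longrightarrow> poly f x = (if (x, \<alpha>1) = z then 1 else 0)"
       "\<And>x. (x, \<alpha>2) \<in> Z \<Longrightarrow> poly g x = (if (x, \<alpha>2) = z then 1 else 0)"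
      and "card (line_section \<alpha>2 Z) \<le> k \<Longrightarrow> degree f < k \<and> degree g < k"
    then have fg: "degree f < k" "degree g < k" using Z(3) by auto
    then have c: "coeff f k = 0" "coeff g k = 0" by (simp_all add: coeff_eq_0)
    have supp: "pair_supported ?M f g" "pair_supported ?N f g"
      using fg c by (auto intro!: pair_supported_M[where k = k] pair_supported_N)
    show ?thesis
      unfolding dual_def using Z(1) by (intro exI[of _ "line_pair \<alpha>1 \<alpha>2 f g"])
        (auto simp: coeff_functional_line_pair[OF ne supp(1)] coeff_functional_line_pair[OF ne supp(2)]
          coeff_functional_None_line_pair[OF ne supp(1)] val c)
  qed
  obtain e where "\<forall>z\<in>Z. dual z (e z)"
    using bchoice[of Z dual] dual_exists by blast
  then have e: "\<And>z. z \<in> Z \<Longrightarrow> coeff_functional k ?M None (e z) = 0"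
    "\<And>z z'. z \<in> Z \<Longrightarrow> z' \<in> Z \<Longrightarrow> coeff_functional k ?M (Some z') (e z) = (if z' = z then 1 else 0)"
    "\<And>z z'. z \<in> Z \<Longrightarrow> z' \<in> Z \<Longrightarrow> coeff_functional k ?N (Some z') (e z) = (if z' = z then 1 else 0)"
    unfolding dual_def by blast+
  have N: "(k, 0) \<notin> ?N" "\<And>m. m \<in> ?N \<Longrightarrow> fst m + snd m \<le> k" by (auto simp: set_mon)
  have "mat_rank (moment_submatrix \<beta> (mon_N k)) = card Z + (if \<delta> \<noteq> 0 \<and> (k, 0) \<in> ?N then 1 else 0)"
    by (rule rank_moment_submatrix[OF distinct_mon(2) N(2) rep refl, where e = "\<lambda>j. e (the j)"])
      (use N(1) in \<open>auto simp: e(3) split: if_splits\<close>)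
  then show "mat_rank (mat_N k \<beta>) = card Z" using N(1) by (simp add: mat_N_eq)
  \<comment> \<open>The dual vector of \<open>None\<close>: both polynomials vanish at the atoms of
    their line and have the common top coefficient 1.\<close>
  define F G where "F = vanishing_poly k (line_section \<alpha>1 Z)" and "G = vanishing_poly k (line_section \<alpha>2 Z)"
  have FG: "degree F \<le> k" "degree G \<le> k" "coeff F k = 1" "coeff G k = 1"
     "\<And>x. (x, \<alpha>1) \<in> Z \<Longrightarrow> poly F x = 0" "\<And>x. (x, \<alpha>2) \<in> Z \<Longrightarrow> poly G x = 0"
    using vanishing_poly[OF sec(1) Z(2)] vanishing_poly[OF sec(2) Z(3)]
    by (auto simp: F_def G_def line_section_def)
  have supp: "pair_supported ?M F G" by (rule pair_supported_M) (use FG in auto)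
  define e' where "e' j = (case j of Some z \<Rightarrow> e z | None \<Rightarrow> line_pair \<alpha>1 \<alpha>2 F G)" for j
  have top: "coeff_functional k ?M None (e' None) = 1"
    using coeff_functional_None_line_pair[OF ne supp] FG by (simp add: e'_def)
  have van: "coeff_functional k ?M (Some z) (e' None) = 0" if "z \<in> Z" for z
    using that Z(1) by (auto simp: e'_def coeff_functional_line_pair[OF ne supp] FG)
  have "mat_rank (moment_submatrix \<beta> (mon_M k)) = card Z + (if \<delta> \<noteq> 0 \<and> (k, 0) \<in> set (mon_M k) then 1 else 0)"
  proof (rule rank_moment_submatrix[OF distinct_mon(1) _ rep refl, where e = e'])
    fix i j
    assume "i \<in> Some ` Z \<union> (if \<delta> \<noteq> 0 \<and> (k, 0) \<in> ?M then {None} else {})"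
      "j \<in> Some ` Z \<union> (if \<delta> \<noteq> 0 \<and> (k, 0) \<in> ?M then {None} else {})"
    then show "coeff_functional k ?M i (e' j) = (if i = j then 1 else 0)"
      using top van e(1,2) by (cases i; cases j) (auto simp: e'_def split: if_splits)
  qed (auto simp: set_mon)
  then show "mat_rank (mat_M k \<beta>) = card Z + (if \<delta> = 0 then 0 else 1)" by (simp add: set_mon mat_M_eq)
qed

section \<open>Hankel matrices of atomic sequences\<close>

lemma coeff_polynomial_sum: "degree p < n \<Longrightarrow> (\<Sum>i<n. x ^ i * coeff p i) = poly p x" for x :: real
  using riesz_eq_sum[of p "n - 1" "\<lambda>i. x ^ i"]
  by (cases n) (auto simp: riesz_def poly_altdef lessThan_Suc_atMost mult.commute)

lemma invertible_mat_iff_det: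
  fixes A :: "'a :: field mat"
  assumes A: "A \<in> carrier_mat n n"
  shows "invertible_mat A \<longleftrightarrow> det A \<noteq> 0"
proof
  assume "invertible_mat A"
  then obtain B where AB: "A * B = 1\<^sub>m n" and BA: "B * A = 1\<^sub>m (dim_row B)"
    using A by (auto simp: invertible_mat_def inverts_mat_def)
  have "dim_col B = n" using arg_cong[OF AB, of dim_col] by simp
  moreover have "dim_row B = n" using arg_cong[OF BA, of dim_col] A by simp
  ultimately have "B \<in> carrier_mat n n" by auto
  then have "det A * det B = 1" using det_mult[OF A] AB by (metis det_one)
  then show "det A \<noteq> 0" by auto
next
  assume "det A \<noteq> 0"
  then have "A \<in> Units (ring_mat TYPE('a) n ())" using A by (intro det_non_zero_imp_unit)
  then obtain B where "B \<in> carrier_mat n n" "A * B = 1\<^sub>m n" "B * A = 1\<^sub>m n"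
    by (auto simp: Units_def ring_mat_def)
  then show "invertible_mat A" using A by (auto simp: invertible_mat_def inverts_mat_def)
qed

text \<open>A Vandermonde factorization in disguise, with Lagrange coefficients as dual vectors: the
  rank is the number of nodes. Weights are only nonzero because they will carry the factor
  \<open>\<alpha>2 - \<alpha>1\<close>, whose sign is not fixed.\<close>

lemma invertible_atomic_hankel_iff:
  fixes w :: "real \<Rightarrow> real"
  assumes "finite X" "card X \<le> k" "\<And>x. x \<in> X \<Longrightarrow> w x \<noteq> 0"
    and H: "H = mat k k (\<lambda>(i, j). \<Sum>x\<in>X. w x * x ^ i * x ^ j)"
  shows "invertible_mat H \<longleftrightarrow> card X = k"
proof -
  have Hc: "H \<in> carrier_mat k k" by (simp add: H)
  have "vec_space.rank k H = card X"
  proof (rule rank_sum_rank_one[OF assms(1,3) H])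
    fix x y assume xy: "x \<in> X" "y \<in> X"
    then have "card X \<noteq> 0" using assms(1) by auto
    then have "degree (lagrange X y) < k"
      using assms(2) degree_lagrange[OF assms(1) xy(2)] by simp
    then show "(\<Sum>i<k. x ^ i * coeff (lagrange X y) i) = (if x = y then 1 else 0)"
      by (auto simp: coeff_polynomial_sum poly_lagrange assms(1) xy)
  qed
  then show ?thesis using vec_space.det_rank_iff[OF Hc] invertible_mat_iff_det[OF Hc] by simp
qed

section \<open>From atomic sequences to measures\<close>

lemma atomic_measure_exists:
  assumes rep: "atomic_rep k \<beta> Z \<rho> 0" and "Z \<subseteq> K"
  shows "\<exists>\<mu>. representing_measure K k \<beta> \<mu> \<and> atomic_measure (card Z) \<mu>"
proof -
  have Z: "finite Z" "\<And>z. z \<in> Z \<Longrightarrow> \<rho> z > 0"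
    and \<beta>: "\<And>i j. i + j \<le> 2 * k \<Longrightarrow> \<beta> i j = (\<Sum>z\<in>Z. \<rho> z * (fst z ^ i * snd z ^ j))"
    using rep by (auto simp: atomic_rep_def)
  \<comment> \<open>A point measure lives on Z with all subsets measurable; pushing it forward along
    the identity gives a Borel measure on the plane.\<close>
  define \<nu> where "\<nu> = point_measure Z (\<lambda>z. ennreal (\<rho> z))"
  define \<mu> where "\<mu> = distr \<nu> borel (\<lambda>z. z)"
  have meas: "(\<lambda>z. z) \<in> measurable \<nu> borel" by (simp add: \<nu>_def)
  have sets: "sets \<mu> = sets borel" by (simp add: \<mu>_def)
  have em: "emeasure \<mu> S = (\<Sum>z\<in>S \<inter> Z. ennreal (\<rho> z))" if "S \<in> sets borel" for S
    unfolding \<mu>_def emeasure_distr[OF meas that]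
    using Z(1) by (simp add: \<nu>_def emeasure_point_measure_finite space_point_measure)
  have "representing_measure K k \<beta> \<mu>"
    unfolding representing_measure_def
  proof (intro conjI allI impI)
    show "measure_support \<mu> \<subseteq> K"
    proof
      fix z assume z: "z \<in> measure_support \<mu>"
      have "z \<in> Z"
      proof (rule ccontr)
        assume "z \<notin> Z"
        moreover have "open (- Z)" using Z(1) by (simp add: finite_imp_closed open_Compl)
        ultimately have "emeasure \<mu> (- Z) > 0" using z by (auto simp: measure_support_def)
        then show False using em[of "- Z"] \<open>open (- Z)\<close> by simp
      qed
      then show "z \<in> K" using assms(2) by auto
    qed
    fix i j assume ij: "i + j \<le> 2 * k"
    let ?f = "\<lambda>(x, y). x ^ i * y ^ j :: real"
    have f: "?f \<in> borel_measurable borel"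
      unfolding case_prod_beta by (intro borel_measurable_continuous_onI continuous_intros)
    have "integrable \<nu> ?f"
      unfolding \<nu>_def by (rule integrable_point_measure_finite[OF Z(1)])
    then show "integrable \<mu> ?f" unfolding \<mu>_def by (simp add: integrable_distr_eq[OF meas f])
    have "(\<integral>z. ?f z \<partial>\<mu>) = (\<integral>z. ?f z \<partial>\<nu>)"
      unfolding \<mu>_def by (rule integral_distr[OF meas f])
    also have "\<dots> = (\<Sum>z\<in>Z. \<rho> z * ?f z)"
      unfolding \<nu>_def using Z by (subst lebesgue_integral_point_measure_finite) (auto intro: less_imp_le)
    finally show "\<beta> i j = (\<integral>z. ?f z \<partial>\<mu>)" using \<beta>[OF ij] by (simp add: case_prod_beta)
  qed (rule sets)
  moreover have "atomic_measure (card Z) \<mu>"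
  proof -
    obtain h where h: "bij_betw h {..<card Z} Z"
      using ex_bij_betw_nat_finite[OF Z(1)] by (auto simp: atLeast0LessThan)
    have "emeasure \<mu> S = (\<Sum>j<card Z. ennreal (\<rho> (h j)) * emeasure (return borel (h j)) S)"
      if S: "S \<in> sets borel" for S
    proof -
      have "emeasure \<mu> S = (\<Sum>z\<in>Z. ennreal (\<rho> z) * emeasure (return borel z) S)"
        unfolding em[OF S] by (rule sum.mono_neutral_cong_left) (use Z(1) S in \<open>auto simp: indicator_def\<close>)
      then show ?thesis
        using sum.reindex_bij_betw[OF h, of "\<lambda>z. ennreal (\<rho> z) * emeasure (return borel z) S"] by simp
    qed
    moreover have "\<rho> (h j) > 0" if "j < card Z" for j
      using that bij_betwE[OF h] Z(2) by blast
    ultimately show ?thesis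
      unfolding atomic_measure_def using bij_betw_imp_inj_on[OF h] sets
      by (intro conjI exI[of _ "\<lambda>j. \<rho> (h j)"] exI[of _ h]) auto
  qed
  ultimately show ?thesis by blast
qed

text \<open>With \<delta> added to the top moment of a sequence with k nodes the form becomes
  definite up to degree k. A monic polynomial of degree k + 1 orthogonal to the degrees below k then
  gives a quadrature with k + 1 nodes that reproduces all moments up to 2k, including the raised
  one.\<close>

lemma absorb_excess:
  assumes rep: "atomic_rep k \<beta> Z \<rho> \<delta>" and \<delta>: "\<delta> > 0" and ne: "\<alpha>1 \<noteq> \<alpha>2"
    and Z: "Z \<subseteq> UNIV \<times> {\<alpha>1, \<alpha>2}" "card (line_section \<alpha>2 Z) = k"
  obtains Z' \<rho>' where "atomic_rep k \<beta> Z' \<rho>' 0" "Z' \<subseteq> UNIV \<times> {\<alpha>1, \<alpha>2}"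
    "line_section \<alpha>1 Z' = line_section \<alpha>1 Z" "card (line_section \<alpha>2 Z') = k + 1"
proof -
  let ?X1 = "line_section \<alpha>1 Z" and ?X2 = "line_section \<alpha>2 Z"
  have fin: "finite Z" and \<rho>: "\<And>z. z \<in> Z \<Longrightarrow> \<rho> z > 0"
    and \<beta>: "\<And>i j. i + j \<le> 2 * k \<Longrightarrow> \<beta> i j = (\<Sum>z\<in>Z. \<rho> z * (fst z ^ i * snd z ^ j)) + (if i = 2 * k then \<delta> else 0)"
    using rep by (auto simp: atomic_rep_def)
  have X: "finite ?X1" "finite ?X2" using finite_line_section[OF fin] by auto
  define \<gamma>0 where "\<gamma>0 i = (\<Sum>x\<in>?X2. \<rho> (x, \<alpha>2) * x ^ i)" for i
  define \<gamma> where "\<gamma> = \<gamma>0(2 * k := \<gamma>0 (2 * k) + \<delta>)"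
  have riesz_\<gamma>: "riesz \<gamma> p = (\<Sum>x\<in>?X2. \<rho> (x, \<alpha>2) * poly p x) + coeff p (2 * k) * \<delta>" if p: "degree p \<le> 2 * k" for p
    using riesz_fun_upd[OF p, of \<gamma>0 "\<gamma>0 (2 * k) + \<delta>"] riesz_atomic[OF _ p, of \<gamma>0 "\<lambda>x. \<rho> (x, \<alpha>2)" ?X2]
    by (simp add: \<gamma>_def \<gamma>0_def)
  have pos: "riesz \<gamma> (f * f) > 0" if f: "f \<noteq> 0" "degree f < k + 1" for f
  proof -
    have deg: "degree f \<le> k" "degree (f * f) \<le> 2 * k"
      using f(2) degree_mult_le[of f f] by auto
    have top: "coeff (f * f) (2 * k) = coeff f k * coeff f k"
    proof (cases "degree f = k")
      case True
      then show ?thesis using coeff_mult_degree_sum[of f f] by (simp add: mult_2)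
    next
      case False
      then show ?thesis using deg degree_mult_le[of f f] by (simp add: coeff_eq_0)
    qed
    have nonneg: "0 \<le> \<rho> (x, \<alpha>2) * poly (f * f) x" if "x \<in> ?X2" for x
      using \<rho>[of "(x, \<alpha>2)"] that by (simp add: line_section_def)
    have "0 \<le> (\<Sum>x\<in>?X2. \<rho> (x, \<alpha>2) * poly (f * f) x)" using nonneg by (rule sum_nonneg)
    moreover have "0 \<le> coeff f k * coeff f k * \<delta>" using \<delta> by simp
    \<comment> \<open>A null vector would have coefficient 0 at x^k because \<delta> > 0, and would
      then be nonzero of degree below k with k roots.\<close>
    moreover have "riesz \<gamma> (f * f) \<noteq> 0"
    proof
      assume "riesz \<gamma> (f * f) = 0"
      then have "(\<Sum>x\<in>?X2. \<rho> (x, \<alpha>2) * poly (f * f) x) = 0" "coeff f k * coeff f k * \<delta> = 0"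
        using calculation unfolding riesz_\<gamma>[OF deg(2)] top by linarith+
      then have "\<forall>x\<in>?X2. \<rho> (x, \<alpha>2) * poly (f * f) x = 0" "coeff f k = 0"
        using sum_nonneg_eq_0_iff[OF X(2) nonneg] \<delta> by auto
      then have zero: "poly f x = 0" if "x \<in> ?X2" for x
        using \<rho>[of "(x, \<alpha>2)"] that by (fastforce simp: line_section_def)
      have "degree f < k"
        using deg(1) \<open>coeff f k = 0\<close> f(1) by (metis le_neq_implies_less leading_coeff_0_iff)
      moreover have "card ?X2 \<le> card {x. poly f x = 0}"
        using zero by (intro card_mono poly_roots_finite f(1)) auto
      moreover have "card {x. poly f x = 0} \<le> degree f" by (rule card_poly_roots_bound[OF f(1)])
      ultimately show False using Z(2) by simp
    qed
    ultimately show ?thesis unfolding riesz_\<gamma>[OF deg(2)] top by linarith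
  qed
  show ?thesis
  proof (rule monic_orthogonal_exists[of k \<gamma> "k + 1"])
    show "f \<noteq> 0 \<Longrightarrow> degree f < k \<Longrightarrow> riesz \<gamma> (f * f) > 0" for f using pos by simp
    fix P assume P: "degree P = k + 1" "lead_coeff P = 1" and orth: "\<And>i. i < k \<Longrightarrow> riesz \<gamma> (P * monom 1 i) = 0"
    show ?thesis
    proof (rule gauss_quadrature[OF P order_refl pos])
      show "i + (k + 1) \<le> 2 * k \<Longrightarrow> riesz \<gamma> (P * monom 1 i) = 0" for i using orth by simp
      fix X w
      assume X': "finite X" "card X = k + 1" and w: "\<And>x. x \<in> X \<Longrightarrow> w x > 0"
        and \<gamma>: "\<And>i. i \<le> 2 * k \<Longrightarrow> \<gamma> i = (\<Sum>x\<in>X. w x * x ^ i)"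
      define Z' where "Z' = ?X1 \<times> {\<alpha>1} \<union> X \<times> {\<alpha>2}"
      define \<rho>' where "\<rho>' z = (if snd z = \<alpha>1 then \<rho> z else w (fst z))" for z :: "real \<times> real"
      have "\<beta> i j = (\<Sum>z\<in>Z'. \<rho>' z * (fst z ^ i * snd z ^ j))" if ij: "i + j \<le> 2 * k" for i j
      proof -
        have "(\<Sum>z\<in>Z. \<rho> z * (fst z ^ i * snd z ^ j)) =
            (\<Sum>x\<in>?X1. \<rho> (x, \<alpha>1) * (x ^ i * \<alpha>1 ^ j)) + \<gamma>0 i * \<alpha>2 ^ j"
          using sum_two_lines[OF X ne, of "\<lambda>z. \<rho> z * (fst z ^ i * snd z ^ j)"]
          unfolding line_section_decomposition[OF Z(1)] by (simp add: \<gamma>0_def sum_distrib_right mult.assoc)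
        moreover have "\<gamma>0 i * \<alpha>2 ^ j + (if i = 2 * k then \<delta> else 0) = \<gamma> i * \<alpha>2 ^ j"
          using ij by (auto simp: \<gamma>_def ring_distribs)
        moreover have "(\<Sum>z\<in>Z'. \<rho>' z * (fst z ^ i * snd z ^ j)) =
            (\<Sum>x\<in>?X1. \<rho> (x, \<alpha>1) * (x ^ i * \<alpha>1 ^ j)) + \<gamma> i * \<alpha>2 ^ j"
          using ne \<gamma>[of i] ij unfolding Z'_def sum_two_lines[OF X(1) X'(1) ne]
          by (simp add: \<rho>'_def sum_distrib_right mult.assoc)
        ultimately show ?thesis using \<beta>[OF ij] by simp
      qed
      then have "atomic_rep k \<beta> Z' \<rho>' 0"
        unfolding atomic_rep_def using X X' w \<rho> ne
        by (auto simp: Z'_def \<rho>'_def line_section_def)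
      moreover have "line_section \<alpha>1 Z' = ?X1" "line_section \<alpha>2 Z' = X"
        using ne by (auto simp: Z'_def line_section_def)
      ultimately show ?thesis using X'(2) by (intro that[of Z' \<rho>']) (auto simp: Z'_def)
    qed auto
  qed auto
qed

text \<open>\<open>B1 - \<alpha>1 A1\<close> holds the moments of (y - \<open>\<alpha>1\<close>), a
  factor that removes the atoms of the first line; the other matrix belongs to
  (\<open>\<alpha>2\<close> - y) and removes those of the second. The powers of x go only up to 2k -
  2, so the excess does not appear.\<close>

lemma hankel_invertible_iff:
  assumes rep: "atomic_rep k \<beta> Z \<rho> \<delta>" and ne: "\<alpha>1 \<noteq> \<alpha>2" and k: "k \<ge> 1"
    and Z: "Z \<subseteq> UNIV \<times> {\<alpha>1, \<alpha>2}" "card (line_section \<alpha>1 Z) \<le> k" "card (line_section \<alpha>2 Z) \<le> k"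
  shows "invertible_mat (mat_B1 k \<beta> - \<alpha>1 \<cdot>\<^sub>m mat_A1 k \<beta>) \<longleftrightarrow> card (line_section \<alpha>2 Z) = k"
    and "invertible_mat (\<alpha>2 \<cdot>\<^sub>m mat_A1 k \<beta> - mat_B1 k \<beta>) \<longleftrightarrow> card (line_section \<alpha>1 Z) = k"
proof -
  let ?X1 = "line_section \<alpha>1 Z" and ?X2 = "line_section \<alpha>2 Z"
  have fin: "finite Z" and \<rho>: "\<And>z. z \<in> Z \<Longrightarrow> \<rho> z > 0"
    and \<beta>: "\<And>i j. i + j \<le> 2 * k \<Longrightarrow> \<beta> i j = (\<Sum>z\<in>Z. \<rho> z * (fst z ^ i * snd z ^ j)) + (if i = 2 * k then \<delta> else 0)"
    using rep by (auto simp: atomic_rep_def)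
  have X: "finite ?X1" "finite ?X2" using finite_line_section[OF fin] by auto
  have entry: "\<beta> i j = (\<Sum>x\<in>?X1. \<rho> (x, \<alpha>1) * x ^ i) * \<alpha>1 ^ j + (\<Sum>x\<in>?X2. \<rho> (x, \<alpha>2) * x ^ i) * \<alpha>2 ^ j"
    if "i + j \<le> 2 * k" "i < 2 * k" for i j
    using \<beta>[OF that(1)] that(2) sum_two_lines[OF X ne, of "\<lambda>z. \<rho> z * (fst z ^ i * snd z ^ j)"]
    unfolding line_section_decomposition[OF Z(1)] by (simp add: sum_distrib_right mult.assoc)
  have "mat_B1 k \<beta> - \<alpha>1 \<cdot>\<^sub>m mat_A1 k \<beta> =
      mat k k (\<lambda>(i, j). \<Sum>x\<in>?X2. (\<alpha>2 - \<alpha>1) * \<rho> (x, \<alpha>2) * x ^ i * x ^ j)"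
  proof (rule eq_matI, simp_all add: mat_B1_def mat_A1_def)
    fix i j assume "i < k" "j < k"
    then have "\<beta> (i + j) 1 - \<alpha>1 * \<beta> (i + j) 0 = (\<alpha>2 - \<alpha>1) * (\<Sum>x\<in>?X2. \<rho> (x, \<alpha>2) * x ^ (i + j))"
      by (simp add: entry algebra_simps)
    then show "\<beta> (i + j) (Suc 0) - \<alpha>1 * \<beta> (i + j) 0 = (\<Sum>x\<in>?X2. (\<alpha>2 - \<alpha>1) * \<rho> (x, \<alpha>2) * x ^ i * x ^ j)"
      by (simp add: sum_distrib_left power_add mult.assoc)
  qed
  then show "invertible_mat (mat_B1 k \<beta> - \<alpha>1 \<cdot>\<^sub>m mat_A1 k \<beta>) \<longleftrightarrow> card ?X2 = k"
    using invertible_atomic_hankel_iff[OF X(2) Z(3), of "\<lambda>x. (\<alpha>2 - \<alpha>1) * \<rho> (x, \<alpha>2)"] ne \<rho>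
    by (force simp: line_section_def)
  have "\<alpha>2 \<cdot>\<^sub>m mat_A1 k \<beta> - mat_B1 k \<beta> =
      mat k k (\<lambda>(i, j). \<Sum>x\<in>?X1. (\<alpha>2 - \<alpha>1) * \<rho> (x, \<alpha>1) * x ^ i * x ^ j)"
  proof (rule eq_matI, simp_all add: mat_B1_def mat_A1_def)
    fix i j assume "i < k" "j < k"
    then have "\<alpha>2 * \<beta> (i + j) 0 - \<beta> (i + j) 1 = (\<alpha>2 - \<alpha>1) * (\<Sum>x\<in>?X1. \<rho> (x, \<alpha>1) * x ^ (i + j))"
      by (simp add: entry algebra_simps)
    then show "\<alpha>2 * \<beta> (i + j) 0 - \<beta> (i + j) (Suc 0) = (\<Sum>x\<in>?X1. (\<alpha>2 - \<alpha>1) * \<rho> (x, \<alpha>1) * x ^ i * x ^ j)"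
      by (simp add: sum_distrib_left power_add mult.assoc)
  qed
  then show "invertible_mat (\<alpha>2 \<cdot>\<^sub>m mat_A1 k \<beta> - mat_B1 k \<beta>) \<longleftrightarrow> card ?X1 = k"
    using invertible_atomic_hankel_iff[OF X(1) Z(2), of "\<lambda>x. (\<alpha>2 - \<alpha>1) * \<rho> (x, \<alpha>1)"] ne \<rho>
    by (force simp: line_section_def)
qed

section \<open>Column relations of sequences with a representing measure\<close>

abbreviation monomials_le :: "nat \<Rightarrow> (nat \<times> nat) set" where
  "monomials_le k \<equiv> {(i, j). i + j \<le> k}"

definition bicoeffs :: "real poly poly \<Rightarrow> nat \<times> nat \<Rightarrow> real" where
  "bicoeffs p m = bicoeff p (fst m) (snd m)"

lemma column_relation_iff_moment_form:
  "column_relation k \<beta> p \<longleftrightarrow> total_degree_le k p \<and> (\<forall>c. moment_form \<beta> (monomials_le k) c (bicoeffs p) = 0)"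
proof -
  let ?S = "monomials_le k"
  let ?r = "\<lambda>m. \<Sum>n\<in>?S. bicoeffs p n * \<beta> (fst m + fst n) (snd m + snd n)"
  have form: "moment_form \<beta> ?S c (bicoeffs p) = (\<Sum>m\<in>?S. c m * ?r m)" for c
    by (simp add: moment_form_def sum_distrib_left mult.assoc)
  have "(\<forall>c. moment_form \<beta> ?S c (bicoeffs p) = 0) \<longleftrightarrow> (\<forall>m\<in>?S. ?r m = 0)"
  proof
    assume L: "\<forall>c. moment_form \<beta> ?S c (bicoeffs p) = 0"
    show "\<forall>m\<in>?S. ?r m = 0"
    proof
      fix m assume m: "m \<in> ?S"
      have "(\<Sum>n\<in>?S. (if n = m then 1 else 0) * ?r n) = (\<Sum>n\<in>?S. if n = m then ?r n else 0)"
        by (rule sum.cong) auto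
      also have "\<dots> = ?r m" using m by (subst sum.delta) (auto simp: finite_monomials_upto)
      finally show "?r m = 0" using L[rule_format, of "\<lambda>n. if n = m then 1 else 0"] unfolding form by simp
    qed
  qed (auto simp: form intro!: sum.neutral)
  then show ?thesis
    by (auto simp: column_relation_iff bicoeffs_def case_prod_beta)
qed

text \<open>\<open>poly p [:snd z:]\<close> puts a constant for the outer variable y and leaves a
  polynomial in x. The parameter \<open>l\<close> is free because evaluation at a point does not
  involve it.\<close>

lemma coeff_functional_bicoeffs:
  assumes "total_degree_le k p"
  shows "coeff_functional l (monomials_le k) (Some z) (bicoeffs p) = poly (poly p [:snd z:]) (fst z)"
proof -
  have upto: "poly q x = (\<Sum>i\<le>k. coeff q i * x ^ i)" if "\<And>i. i > k \<Longrightarrow> coeff q i = 0"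
    for q :: "'a :: comm_ring_1 poly" and x
  proof -
    have "degree q \<le> k" using that by (intro degree_le) auto
    then show ?thesis
      unfolding poly_altdef by (intro sum.mono_neutral_left) (auto simp: coeff_eq_0)
  qed
  have zero: "coeff (coeff p j) i = 0" if "i + j > k" for i j
    using assms that unfolding total_degree_le_def bicoeff_def by (metis not_less)
  have "poly p [:snd z:] = (\<Sum>j\<le>k. coeff p j * [:snd z:] ^ j)"
    by (rule upto) (auto intro!: poly_eqI zero)
  then have "poly (poly p [:snd z:]) (fst z) = (\<Sum>j\<le>k. poly (coeff p j) (fst z) * snd z ^ j)"
    by (simp add: poly_sum)
  also have "\<dots> = (\<Sum>j\<le>k. \<Sum>i\<le>k. coeff (coeff p j) i * fst z ^ i * snd z ^ j)"
    by (simp add: upto zero sum_distrib_right)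
  also have "\<dots> = (\<Sum>i\<le>k. \<Sum>j\<le>k. coeff (coeff p j) i * fst z ^ i * snd z ^ j)"
    by (rule sum.swap)
  also have "\<dots> = (\<Sum>(i, j)\<in>{..k} \<times> {..k}. coeff (coeff p j) i * fst z ^ i * snd z ^ j)"
    by (rule sum.cartesian_product)
  also have "\<dots> = (\<Sum>(i, j)\<in>monomials_le k. coeff (coeff p j) i * fst z ^ i * snd z ^ j)"
  proof (rule sum.mono_neutral_right)
    have "coeff (coeff p (snd m)) (fst m) = 0" if "m \<in> {..k} \<times> {..k} - monomials_le k" for m
      using that by (cases m) (auto simp: not_le intro: zero)
    then show "\<forall>m\<in>{..k} \<times> {..k} - monomials_le k.
        (case m of (i, j) \<Rightarrow> coeff (coeff p j) i * fst z ^ i * snd z ^ j) = 0"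
      by (simp add: case_prod_beta)
  qed auto
  finally show ?thesis
    by (simp add: coeff_functional_def monomial_functional_def bicoeffs_def bicoeff_def case_prod_beta mult.assoc)
qed

text \<open>Each point outside the support has an open neighbourhood of measure 0. These
  neighbourhoods may be uncountably many, and the Lindelof property reduces their union to a
  countable one.\<close>

lemma AE_in_support_superset:
  assumes sets: "sets \<mu> = sets borel" and "measure_support \<mu> \<subseteq> K"
  shows "AE z in \<mu>. z \<in> K"
proof -
  define \<F> where "\<F> = {U. open U \<and> emeasure \<mu> U = 0}"
  obtain \<F>' where \<F>': "\<F>' \<subseteq> \<F>" "countable \<F>'" "\<Union>\<F>' = \<Union>\<F>"
    by (rule Lindelof[of \<F>]) (auto simp: \<F>_def)
  have "U \<in> null_sets \<mu>" if "U \<in> \<F>'" for U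
  proof (rule null_setsI)
    have "U \<in> \<F>" using that \<F>'(1) by blast
    then show "emeasure \<mu> U = 0" "U \<in> sets \<mu>" unfolding \<F>_def sets by simp_all
  qed
  then have "(\<Union>U\<in>\<F>'. U) \<in> null_sets \<mu>" by (rule null_sets_UN'[OF \<F>'(2)])
  moreover have "{z \<in> space \<mu>. z \<notin> K} \<subseteq> (\<Union>U\<in>\<F>'. U)"
  proof
    fix z assume "z \<in> {z \<in> space \<mu>. z \<notin> K}"
    then have "z \<notin> measure_support \<mu>" using assms(2) by blast
    then obtain U where "open U" "z \<in> U" "\<not> emeasure \<mu> U > 0" unfolding measure_support_def by blast
    then have "U \<in> \<F>" "z \<in> U" by (simp_all add: \<F>_def)
    then have "z \<in> \<Union>\<F>'" unfolding \<F>'(3) by blast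
    then show "z \<in> (\<Union>U\<in>\<F>'. U)" by simp
  qed
  ultimately show ?thesis by (rule AE_I')
qed

lemma moment_form_integral:
  assumes \<mu>: "representing_measure K k \<beta> \<mu>" and S: "\<And>m. m \<in> S \<Longrightarrow> fst m + snd m \<le> k"
  shows "integrable \<mu> (\<lambda>z. coeff_functional l S (Some z) c * coeff_functional l S (Some z) d)"
    and "moment_form \<beta> S c d = (\<integral>z. coeff_functional l S (Some z) c * coeff_functional l S (Some z) d \<partial>\<mu>)"
proof -
  let ?mon = "\<lambda>m n z. fst z ^ (fst m + fst n) * snd z ^ (snd m + snd n) :: real"
  have mon: "integrable \<mu> (?mon m n)" "\<beta> (fst m + fst n) (snd m + snd n) = (\<integral>z. ?mon m n z \<partial>\<mu>)"
    if "m \<in> S" "n \<in> S" for m n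
  proof -
    have "\<forall>i j. i + j \<le> 2 * k \<longrightarrow> integrable \<mu> (\<lambda>z. fst z ^ i * snd z ^ j) \<and>
        \<beta> i j = (\<integral>z. fst z ^ i * snd z ^ j \<partial>\<mu>)"
      using \<mu> unfolding representing_measure_def case_prod_beta by blast
    moreover have "(fst m + fst n) + (snd m + snd n) \<le> 2 * k"
      using S[OF that(1)] S[OF that(2)] by simp
    ultimately show "integrable \<mu> (?mon m n)" "\<beta> (fst m + fst n) (snd m + snd n) = (\<integral>z. ?mon m n z \<partial>\<mu>)"
      by blast+
  qed
  have eq: "coeff_functional l S (Some z) c * coeff_functional l S (Some z) d =
      (\<Sum>m\<in>S. \<Sum>n\<in>S. c m * d n * ?mon m n z)" for z
    unfolding coeff_functional_def monomial_functional_def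
    by (simp add: sum_product power_add mult_ac)
  have int: "integrable \<mu> (\<lambda>z. c m * d n * ?mon m n z)" if "m \<in> S" "n \<in> S" for m n
    using mon(1)[OF that] by (rule integrable_mult_right)
  have int': "integrable \<mu> (\<lambda>z. \<Sum>n\<in>S. c m * d n * ?mon m n z)" if "m \<in> S" for m
    by (rule Bochner_Integration.integrable_sum) (rule int[OF that])
  show "integrable \<mu> (\<lambda>z. coeff_functional l S (Some z) c * coeff_functional l S (Some z) d)"
    unfolding eq by (rule Bochner_Integration.integrable_sum) (rule int')
  have "(\<integral>z. (\<Sum>m\<in>S. \<Sum>n\<in>S. c m * d n * ?mon m n z) \<partial>\<mu>) = (\<Sum>m\<in>S. \<integral>z. (\<Sum>n\<in>S. c m * d n * ?mon m n z) \<partial>\<mu>)"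
    by (rule Bochner_Integration.integral_sum) (rule int')
  also have "\<dots> = (\<Sum>m\<in>S. \<Sum>n\<in>S. \<integral>z. c m * d n * ?mon m n z \<partial>\<mu>)"
    by (intro sum.cong refl Bochner_Integration.integral_sum) (rule int)
  also have "\<dots> = (\<Sum>m\<in>S. \<Sum>n\<in>S. c m * d n * \<beta> (fst m + fst n) (snd m + snd n))"
    by (intro sum.cong refl) (simp add: mon(2))
  finally show "moment_form \<beta> S c d = (\<integral>z. coeff_functional l S (Some z) c * coeff_functional l S (Some z) d \<partial>\<mu>)"
    unfolding eq moment_form_def by simp
qed

lemma moment_form_integral_monomials_le:
  assumes "representing_measure K k \<beta> \<mu>"
  defines "e \<equiv> \<lambda>z. coeff_functional k (monomials_le k) (Some z)"
  shows "integrable \<mu> (\<lambda>z. e z c * e z d)"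
    and "moment_form \<beta> (monomials_le k) c d = (\<integral>z. e z c * e z d \<partial>\<mu>)"
  unfolding e_def by (rule moment_form_integral[OF assms(1)]; auto)+

text \<open>Testing the relation against p itself gives integral 0 of p^2, hence p = 0 almost
  everywhere; conversely every product with p then integrates to 0. In this form the passage from p
  to \<open>p * q\<close> is immediate, which is recursive generation.\<close>

lemma column_relation_iff_AE:
  assumes \<mu>: "representing_measure K k \<beta> \<mu>"
  shows "column_relation k \<beta> p \<longleftrightarrow> total_degree_le k p \<and> (AE z in \<mu>. poly (poly p [:snd z:]) (fst z) = 0)"
proof (cases "total_degree_le k p")
  case deg: True
  let ?S = "monomials_le k" and ?e = "\<lambda>z c. coeff_functional k (monomials_le k) (Some z) c"
  note form = moment_form_integral_monomials_le[OF \<mu>]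
  have "column_relation k \<beta> p \<longleftrightarrow> (AE z in \<mu>. ?e z (bicoeffs p) = 0)"
  proof
    assume "column_relation k \<beta> p"
    then have "moment_form \<beta> ?S (bicoeffs p) (bicoeffs p) = 0"
      by (simp add: column_relation_iff_moment_form)
    then have "(\<integral>z. ?e z (bicoeffs p) * ?e z (bicoeffs p) \<partial>\<mu>) = 0"
      using form(2)[of "bicoeffs p" "bicoeffs p"] by simp
    then have "AE z in \<mu>. ?e z (bicoeffs p) * ?e z (bicoeffs p) = 0"
      using integral_nonneg_eq_0_iff_AE[OF form(1)[of "bicoeffs p" "bicoeffs p"]] by simp
    then show "AE z in \<mu>. ?e z (bicoeffs p) = 0" by simp
  next
    assume ae: "AE z in \<mu>. ?e z (bicoeffs p) = 0"
    have "moment_form \<beta> ?S c (bicoeffs p) = 0" for c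
    proof -
      have "AE z in \<mu>. ?e z c * ?e z (bicoeffs p) = 0" using ae by (rule AE_mp) simp
      then have "(\<integral>z. ?e z c * ?e z (bicoeffs p) \<partial>\<mu>) = 0" by (rule integral_eq_zero_AE)
      then show ?thesis using form(2)[of c "bicoeffs p"] by simp
    qed
    then show "column_relation k \<beta> p" using deg by (simp add: column_relation_iff_moment_form)
  qed
  then show ?thesis using deg by (simp add: coeff_functional_bicoeffs)
qed (simp add: column_relation_def)

lemma two_lines_poly:
  "[:[:- \<alpha>1:], 1:] * [:[:- \<alpha>2:], 1:] = [:[:\<alpha>1 * \<alpha>2:], [:- (\<alpha>1 + \<alpha>2):], 1 :: real poly:]"
  by (simp add: one_pCons)

lemma total_degree_two_lines_poly:
  assumes "k \<ge> 2"
  shows "total_degree_le k ([:[:- \<alpha>1:], 1:] * [:[:- \<alpha>2:], 1:])"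
  unfolding two_lines_poly using assms
  by (auto simp: total_degree_le_def bicoeff_def coeff_pCons one_pCons split: nat.splits if_splits)

lemma representing_imp_recursive:
  assumes "k \<ge> 2" and K: "K = {(x, y). (y - \<alpha>1) * (y - \<alpha>2) = 0}" and \<mu>: "representing_measure K k \<beta> \<mu>"
  shows "psd (moment_matrix k \<beta>) \<and> recursively_generated k \<beta> \<and>
    column_relation k \<beta> ([:[:- \<alpha>1:], 1:] * [:[:- \<alpha>2:], 1:])"
proof (intro conjI)
  show "psd (moment_matrix k \<beta>)"
    unfolding moment_matrix_def psd_moment_submatrix_iff[OF distinct_monomials_upto] set_monomials_upto
    by (simp add: moment_form_integral_monomials_le(2)[OF \<mu>])
  show "recursively_generated k \<beta>"
    unfolding recursively_generated_def column_relation_iff_AE[OF \<mu>] by auto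
  have "AE z in \<mu>. z \<in> K"
    using \<mu> unfolding representing_measure_def by (intro AE_in_support_superset) auto
  then have "AE z in \<mu>. poly (poly ([:[:- \<alpha>1:], 1:] * [:[:- \<alpha>2:], 1:]) [:snd z:]) (fst z) = 0"
    by (rule AE_mp) (auto simp: K)
  then show "column_relation k \<beta> ([:[:- \<alpha>1:], 1:] * [:[:- \<alpha>2:], 1:])"
    unfolding column_relation_iff_AE[OF \<mu>] using total_degree_two_lines_poly[OF assms(1)] by blast
qed

section \<open>Consequences of recursive generation\<close>

lemma psd_mat_M_if_psd_moment_matrix:
  assumes "psd (moment_matrix k \<beta>)"
  shows "psd (mat_M k \<beta>)"
proof -
  let ?T = "set (mon_M k)" and ?S = "monomials_le k"
  have TS: "?T \<subseteq> ?S" by (auto simp: set_mon)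
  have "moment_form \<beta> ?T c c = moment_form \<beta> ?S (\<lambda>m. if m \<in> ?T then c m else 0) (\<lambda>m. if m \<in> ?T then c m else 0)" for c
  proof -
    let ?g = "\<lambda>(m, n). (if m \<in> ?T then c m else 0) * (if n \<in> ?T then c n else 0) * \<beta> (fst m + fst n) (snd m + snd n)"
    have "moment_form \<beta> ?T c c = (\<Sum>p\<in>?T \<times> ?T. ?g p)"
      unfolding moment_form_def sum.cartesian_product by (rule sum.cong) auto
    also have "\<dots> = (\<Sum>p\<in>?S \<times> ?S. ?g p)"
      by (rule sum.mono_neutral_left) (use TS in \<open>auto simp: finite_monomials_upto split: if_splits\<close>)
    finally show ?thesis by (simp add: moment_form_def sum.cartesian_product)
  qed
  then show ?thesis
    using assms
    by (simp add: mat_M_eq moment_matrix_def psd_moment_submatrix_iff distinct_mon distinct_monomials_upto set_monomials_upto)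
qed

text \<open>Recursive generation multiplies the quadratic relation by a monomial x^a y^b of degree
  at most k - 2, and the row X^(i - a) Y^(j - b) of the result is the desired equation.\<close>

lemma recurrence_if_column_relation:
  assumes k: "k \<ge> 2" and rg: "recursively_generated k \<beta>"
    and col: "column_relation k \<beta> ([:[:- \<alpha>1:], 1:] * [:[:- \<alpha>2:], 1:])"
    and ij: "i + j \<le> 2 * k - 2"
  shows "\<beta> i (j + 2) = (\<alpha>1 + \<alpha>2) * \<beta> i (j + 1) - \<alpha>1 * \<alpha>2 * \<beta> i j"
proof -
  let ?R = "[:[:- \<alpha>1:], 1:] * [:[:- \<alpha>2:], 1:] :: real poly poly"
  \<comment> \<open>As much of the monomial as fits into degree k - 2 goes to the multiplier, powers
    of x taking precedence; since \<open>i + j \<le> 2 * k - 2\<close>, the rest has degree at most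
    k and indexes a row.\<close>
  define a b where "a = min i (k - 2)" and "b = min j (k - 2 - a)"
  have ab: "a \<le> i" "b \<le> j" "a + b \<le> k - 2" "(i - a) + (j - b) \<le> k"
    using k ij by (auto simp: a_def b_def min_def)
  define q :: "real poly poly" where "q = monom (monom 1 a) b"
  have bi_R: "bicoeff ?R i' j' = (if i' = 0 \<and> j' = 0 then \<alpha>1 * \<alpha>2 else if i' = 0 \<and> j' = 1 then - (\<alpha>1 + \<alpha>2)
      else if i' = 0 \<and> j' = 2 then 1 else 0)" for i' j'
    unfolding two_lines_poly bicoeff_def
    by (cases j'; cases "j' - 1"; cases "j' - 2"; cases i') (auto simp: coeff_pCons one_pCons split: nat.splits)
  have bi: "bicoeff (?R * q) i' j' = (if a \<le> i' \<and> b \<le> j' then bicoeff ?R (i' - a) (j' - b) else 0)" for i' j'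
    unfolding q_def mult.commute[of ?R] by (simp only: bicoeff_def coeff_monom_mult) (simp add: coeff_monom_mult)
  have "total_degree_le k q" "total_degree_le k (?R * q)"
    using ab(3) k unfolding total_degree_le_def bi bi_R
    by (auto simp: q_def bicoeff_def split: if_splits)
  moreover have "total_degree_le k ?R" using col by (simp add: column_relation_def)
  ultimately have "column_relation k \<beta> (?R * q)"
    using rg col unfolding recursively_generated_def by blast
  then have "(\<Sum>(i', j')\<in>monomials_le k. bicoeff (?R * q) i' j' * \<beta> (i - a + i') (j - b + j')) = 0"
    using ab(4) unfolding column_relation_iff by blast
  also have "(\<Sum>(i', j')\<in>monomials_le k. bicoeff (?R * q) i' j' * \<beta> (i - a + i') (j - b + j')) =
      (\<Sum>(i', j')\<in>{(a, b), (a, b + 1), (a, b + 2)}. bicoeff (?R * q) i' j' * \<beta> (i - a + i') (j - b + j'))"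
  proof (rule sum.mono_neutral_right[OF finite_monomials_upto])
    show "{(a, b), (a, b + 1), (a, b + 2)} \<subseteq> monomials_le k" using ab(3) k by auto
    show "\<forall>m\<in>monomials_le k - {(a, b), (a, b + 1), (a, b + 2)}.
        (case m of (i', j') \<Rightarrow> bicoeff (?R * q) i' j' * \<beta> (i - a + i') (j - b + j')) = 0"
      unfolding bi bi_R by (auto split: if_splits)
  qed
  also have "\<dots> = \<alpha>1 * \<alpha>2 * \<beta> i j - (\<alpha>1 + \<alpha>2) * \<beta> i (j + 1) + \<beta> i (j + 2)"
    unfolding bi bi_R using ab(1,2) by (simp add: algebra_simps)
  finally show ?thesis by simp
qed

lemma moment_form_atomic_rep_monomials_le:
  assumes "atomic_rep k \<beta> Z \<rho> \<delta>"
  defines "e \<equiv> coeff_functional k (monomials_le k)"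
  shows "moment_form \<beta> (monomials_le k) c d =
    (\<Sum>z\<in>Z. \<rho> z * e (Some z) c * e (Some z) d) + \<delta> * e None c * e None d"
  unfolding e_def by (rule moment_form_atomic_rep[OF assms(1)]) auto

text \<open>Vanishing at the atoms removes their rank-one terms, and a zero coefficient at x^k hides
  p from the excess.\<close>

lemma column_relation_if_vanishing:
  assumes rep: "atomic_rep k \<beta> Z \<rho> \<delta>" and deg: "total_degree_le k p" and top: "bicoeff p k 0 = 0"
    and van: "\<And>z. z \<in> Z \<Longrightarrow> poly (poly p [:snd z:]) (fst z) = 0"
  shows "column_relation k \<beta> p"
proof -
  have "coeff_functional k (monomials_le k) None (bicoeffs p) = 0"
    unfolding coeff_functional_def monomial_functional_def bicoeffs_def
    by (rule sum.neutral) (use top in auto)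
  then have "moment_form \<beta> (monomials_le k) c (bicoeffs p) = 0" for c
    unfolding moment_form_atomic_rep_monomials_le[OF rep]
    by (simp add: coeff_functional_bicoeffs[OF deg] van)
  then show ?thesis using deg by (simp add: column_relation_iff_moment_form)
qed

lemma excess_zero_if_recursively_generated:
  assumes rep: "atomic_rep k \<beta> Z \<rho> \<delta>" and ne: "\<alpha>1 \<noteq> \<alpha>2" and rg: "recursively_generated k \<beta>"
    and Z: "Z \<subseteq> UNIV \<times> {\<alpha>1, \<alpha>2}" "card (line_section \<alpha>1 Z) < k" "card (line_section \<alpha>2 Z) < k"
  shows "\<delta> = 0"
proof -
  let ?X1 = "line_section \<alpha>1 Z" and ?X2 = "line_section \<alpha>2 Z"
  have fin: "finite Z" using rep by (simp add: atomic_rep_def)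
  have X: "finite ?X1" "finite ?X2" using finite_line_section[OF fin] by auto
  have card: "card ?X1 \<le> k - 1" "card ?X2 \<le> k - 1" and k: "k \<ge> 1" using Z(2,3) by auto
  define f g where "f = vanishing_poly (k - 1) ?X1" and "g = vanishing_poly (k - 1) ?X2"
  note f = vanishing_poly[OF X(1) card(1), folded f_def]
  note g = vanishing_poly[OF X(2) card(2), folded g_def]
  \<comment> \<open>The coefficients of y^0 and y^1 in f (y - \<open>\<alpha>2\<close>) - g (y -
    \<open>\<alpha>1\<close>). The leading terms cancel in \<open>h1\<close>, which keeps its
    product with y within degree k - 1; in \<open>h0\<close> they leave
    \<open>\<alpha>1 - \<alpha>2\<close> at x^(k - 1).\<close>
  define h0 h1 where "h0 = smult \<alpha>1 g - smult \<alpha>2 f" and "h1 = f - g"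
  have h: "coeff h0 i \<noteq> 0 \<Longrightarrow> i \<le> k - 1" "coeff h1 i \<noteq> 0 \<Longrightarrow> i < k - 1" for i
  proof -
    show "coeff h0 i \<noteq> 0 \<Longrightarrow> i \<le> k - 1"
      using f(1) g(1) coeff_eq_0[of f i] coeff_eq_0[of g i] by (cases "i \<le> k - 1") (auto simp: h0_def)
    show "coeff h1 i \<noteq> 0 \<Longrightarrow> i < k - 1"
      using f(1,2) g(1,2) coeff_eq_0[of f i] coeff_eq_0[of g i]
      by (cases i "k - 1" rule: linorder_cases) (auto simp: h1_def)
  qed
  define p where "p = [:h0, h1:]"
  define q :: "real poly poly" where "q = [:[:0, 1:]:]"
  have bp: "bicoeff p i j = (if j = 0 then coeff h0 i else if j = 1 then coeff h1 i else 0)" for i j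
    by (cases j; cases "j - 1") (auto simp: p_def bicoeff_def coeff_pCons split: nat.splits)
  have bpq: "bicoeff (p * q) i j = (if i = 0 then 0 else bicoeff p (i - 1) j)" for i j
    by (cases i; cases j; cases "j - 1") (auto simp: p_def q_def bicoeff_def coeff_pCons split: nat.splits)
  have bq: "bicoeff q i j = (if i = 1 \<and> j = 0 then 1 else 0)" for i j
    by (cases i; cases j; cases "i - 1") (auto simp: q_def bicoeff_def coeff_pCons split: nat.splits)
  have bp_deg: "i + j \<le> k - 1" if "bicoeff p i j \<noteq> 0" for i j
    using that h[of i] unfolding bp by (auto split: if_splits)
  have bpq_deg: "i + j \<le> k" if "bicoeff (p * q) i j \<noteq> 0" for i j
  proof -
    have "i \<noteq> 0" "bicoeff p (i - 1) j \<noteq> 0" using that by (auto simp: bpq split: if_splits)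
    then show ?thesis using bp_deg[of "i - 1" j] k by simp
  qed
  have deg: "total_degree_le k p" "total_degree_le k q" "total_degree_le k (p * q)"
    unfolding total_degree_le_def using bp_deg bpq_deg k by (auto simp: bq intro: le_trans[OF _ diff_le_self])
  have van: "poly (poly p [:snd z:]) (fst z) = 0" if "z \<in> Z" for z
  proof -
      have "poly (poly p [:snd z:]) (fst z) = (snd z - \<alpha>2) * poly f (fst z) - (snd z - \<alpha>1) * poly g (fst z)"
        by (simp add: p_def h0_def h1_def algebra_simps)
      moreover have "snd z = \<alpha>1 \<and> fst z \<in> ?X1 \<or> snd z = \<alpha>2 \<and> fst z \<in> ?X2"
        using that Z(1) by (cases z) (auto simp: line_section_def)
      ultimately show ?thesis using f(3) g(3) by auto
  qed
  have "bicoeff p k 0 = 0" using h(1)[of k] k by (cases "coeff h0 k = 0") (auto simp: bp)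
  then have "column_relation k \<beta> p" by (rule column_relation_if_vanishing[OF rep deg(1) _ van])
  then have "column_relation k \<beta> (p * q)" using rg deg unfolding recursively_generated_def by blast
  then have "moment_form \<beta> (monomials_le k) (bicoeffs (p * q)) (bicoeffs (p * q)) = 0"
    by (simp add: column_relation_iff_moment_form)
  moreover have "poly (poly (p * q) [:snd z:]) (fst z) = 0" if "z \<in> Z" for z
    using van[OF that] by simp
  moreover have "coeff_functional k (monomials_le k) None (bicoeffs (p * q)) = bicoeff (p * q) k 0"
    unfolding coeff_functional_def monomial_functional_def bicoeffs_def
    by (subst sum.mono_neutral_right[of _ "{(k, 0)}"]) (auto simp: finite_monomials_upto)
  \<comment> \<open>The form is taken at \<open>p * q\<close> itself: the atoms contribute nothing,
    and the excess contributes \<delta> times the square of the coefficient at x^k.\<close>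
  ultimately have "\<delta> * bicoeff (p * q) k 0 * bicoeff (p * q) k 0 = 0"
    unfolding moment_form_atomic_rep_monomials_le[OF rep]
    by (simp add: coeff_functional_bicoeffs[OF deg(3)])
  moreover have "bicoeff (p * q) k 0 = \<alpha>1 - \<alpha>2"
    using k f(2) g(2) by (simp add: bpq bp h0_def)
  ultimately show ?thesis using ne by simp
qed

section \<open>Closing the cycle of implications\<close>

lemma atomic_rep_imp_rank_atomic_measure:
  assumes rep: "atomic_rep k \<beta> Z \<rho> 0" and ne: "\<alpha>1 \<noteq> \<alpha>2"
    and Z: "Z \<subseteq> UNIV \<times> {\<alpha>1, \<alpha>2}" "card (line_section \<alpha>1 Z) \<le> k" "card (line_section \<alpha>2 Z) \<le> k + 1"
    and K: "UNIV \<times> {\<alpha>1, \<alpha>2} \<subseteq> K"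
  shows "\<exists>\<mu>. representing_measure K k \<beta> \<mu> \<and> atomic_measure (mat_rank (moment_matrix k \<beta>)) \<mu>"
proof -
  have "mat_rank (moment_matrix k \<beta>) = card Z"
    unfolding moment_matrix_def
    by (rule rank_atomic_rep[OF rep ne Z distinct_monomials_upto]) (auto simp: set_monomials_upto set_mon)
  then show ?thesis using atomic_measure_exists[OF rep, of K] Z(1) K by auto
qed

lemma rank_atomic_measure_if_criterion:
  assumes k: "k \<ge> 2" and ne: "\<alpha>1 \<noteq> \<alpha>2" and K: "UNIV \<times> {\<alpha>1, \<alpha>2} \<subseteq> K" and psd: "psd (mat_M k \<beta>)"
    and rec: "\<And>i j. i + j \<le> 2 * k - 2 \<Longrightarrow> \<beta> i (j + 2) = (\<alpha>1 + \<alpha>2) * \<beta> i (j + 1) - \<alpha>1 * \<alpha>2 * \<beta> i j"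
    and crit: "invertible_mat (mat_B1 k \<beta> - \<alpha>1 \<cdot>\<^sub>m mat_A1 k \<beta>) \<or>
      invertible_mat (\<alpha>2 \<cdot>\<^sub>m mat_A1 k \<beta> - mat_B1 k \<beta>) \<or> mat_rank (mat_M k \<beta>) = mat_rank (mat_N k \<beta>)"
  shows "\<exists>\<mu>. representing_measure K k \<beta> \<mu> \<and> atomic_measure (mat_rank (moment_matrix k \<beta>)) \<mu>"
proof -
  have k1: "k \<ge> 1" using k by simp
  show ?thesis
  proof (rule two_line_structure[OF ne k1 psd rec])
    fix Z \<rho> \<delta>
    assume rep: "atomic_rep k \<beta> Z \<rho> \<delta>" and Z: "Z \<subseteq> UNIV \<times> {\<alpha>1, \<alpha>2}"
      and card: "card (line_section \<alpha>1 Z) \<le> k" "card (line_section \<alpha>2 Z) \<le> k"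
    \<comment> \<open>Absorption is formulated for the second line; the first is reached by
      exchanging \<open>\<alpha>1\<close> and \<open>\<alpha>2\<close>, under which the set of the
      two lines is unchanged.\<close>
    have swap: "UNIV \<times> {\<alpha>1, \<alpha>2} = UNIV \<times> {\<alpha>2, \<alpha>1}" by auto
    have "\<delta> \<ge> 0" using rep by (simp add: atomic_rep_def)
    moreover have "mat_rank (mat_M k \<beta>) = mat_rank (mat_N k \<beta>) \<Longrightarrow> \<delta> = 0"
      using rank_M_N_atomic_rep[OF rep ne Z card] by (simp split: if_splits)
    ultimately consider "\<delta> = 0" | "\<delta> > 0" "card (line_section \<alpha>2 Z) = k" | "\<delta> > 0" "card (line_section \<alpha>1 Z) = k"
      using crit hankel_invertible_iff[OF rep ne k1 Z card] by fastforce
    then show ?thesis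
    proof cases
      case 1
      then show ?thesis
        using atomic_rep_imp_rank_atomic_measure[OF _ ne Z card(1) _ K] rep card(2) by simp
    next
      case 2
      show ?thesis
      proof (rule absorb_excess[OF rep 2(1) ne Z 2(2)])
        fix Z' \<rho>'
        assume "atomic_rep k \<beta> Z' \<rho>' 0" "Z' \<subseteq> UNIV \<times> {\<alpha>1, \<alpha>2}"
          "line_section \<alpha>1 Z' = line_section \<alpha>1 Z" "card (line_section \<alpha>2 Z') = k + 1"
        then show ?thesis
          using atomic_rep_imp_rank_atomic_measure[OF _ ne _ _ _ K] card(1) by simp
      qed
    next
      case 3
      show ?thesis
      proof (rule absorb_excess[OF rep 3(1) ne[symmetric] Z[unfolded swap] 3(2)])
        fix Z' \<rho>'
        assume "atomic_rep k \<beta> Z' \<rho>' 0" "Z' \<subseteq> UNIV \<times> {\<alpha>2, \<alpha>1}"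
          "line_section \<alpha>2 Z' = line_section \<alpha>2 Z" "card (line_section \<alpha>1 Z') = k + 1"
        then show ?thesis
          using atomic_rep_imp_rank_atomic_measure[OF _ ne[symmetric] _ _ _ K[unfolded swap]] card(2) by simp
      qed
    qed
  qed
qed

lemma criterion_if_recursively_generated:
  assumes k: "k \<ge> 2" and ne: "\<alpha>1 \<noteq> \<alpha>2" and psd: "psd (moment_matrix k \<beta>)" and rg: "recursively_generated k \<beta>"
    and col: "column_relation k \<beta> ([:[:- \<alpha>1:], 1:] * [:[:- \<alpha>2:], 1:])"
  shows "invertible_mat (mat_B1 k \<beta> - \<alpha>1 \<cdot>\<^sub>m mat_A1 k \<beta>) \<or>
      invertible_mat (\<alpha>2 \<cdot>\<^sub>m mat_A1 k \<beta> - mat_B1 k \<beta>) \<or> mat_rank (mat_M k \<beta>) = mat_rank (mat_N k \<beta>)"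
proof -
  have k1: "k \<ge> 1" using k by simp
  show ?thesis
  proof (rule two_line_structure[OF ne k1 psd_mat_M_if_psd_moment_matrix[OF psd] recurrence_if_column_relation[OF k rg col]])
    fix Z \<rho> \<delta>
    assume rep: "atomic_rep k \<beta> Z \<rho> \<delta>" and Z: "Z \<subseteq> UNIV \<times> {\<alpha>1, \<alpha>2}"
      and card: "card (line_section \<alpha>1 Z) \<le> k" "card (line_section \<alpha>2 Z) \<le> k"
    note inv = hankel_invertible_iff[OF rep ne k1 Z card]
    show ?thesis
    proof (cases "card (line_section \<alpha>1 Z) = k \<or> card (line_section \<alpha>2 Z) = k")
      case True
      then show ?thesis using inv by blast
    next
      case False
      then have "\<delta> = 0"
        using card by (intro excess_zero_if_recursively_generated[OF rep ne rg Z]) auto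
      then show ?thesis using rank_M_N_atomic_rep[OF rep ne Z card] by simp
    qed
  qed
qed

theorem theorem3p1:
  fixes k :: nat and \<alpha>1 \<alpha>2 :: real and \<beta> :: "nat \<Rightarrow> nat \<Rightarrow> real"
    and K :: "(real \<times> real) set"
  assumes "k \<ge> 2"
    and "\<alpha>1 \<noteq> \<alpha>2"
    and "K = {(x, y). (y - \<alpha>1) * (y - \<alpha>2) = 0}"
    and "\<beta> 0 0 > 0"
  defines "S1 \<equiv> \<exists>\<mu>. representing_measure K k \<beta> \<mu>"
    and "S2 \<equiv> \<exists>\<mu>. representing_measure K k \<beta> \<mu> \<and>
                 atomic_measure (mat_rank (moment_matrix k \<beta>)) \<mu>"
    and "S3 \<equiv> psd (moment_matrix k \<beta>) \<and> recursively_generated k \<beta> \<and>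
                 column_relation k \<beta> ([:[:- \<alpha>1:], 1:] * [:[:- \<alpha>2:], 1:])"
    and "S4 \<equiv> psd (mat_M k \<beta>) \<and>
                 (\<forall>i j. i + j \<le> 2 * k - 2 \<longrightarrow>
                    \<beta> i (j + 2) = (\<alpha>1 + \<alpha>2) * \<beta> i (j + 1) - \<alpha>1 * \<alpha>2 * \<beta> i j) \<and>
                 (invertible_mat (mat_B1 k \<beta> - \<alpha>1 \<cdot>\<^sub>m mat_A1 k \<beta>) \<or>
                  invertible_mat (\<alpha>2 \<cdot>\<^sub>m mat_A1 k \<beta> - mat_B1 k \<beta>) \<or>
                  mat_rank (mat_M k \<beta>) = mat_rank (mat_N k \<beta>))"
  shows "(S1 \<longleftrightarrow> S2) \<and> (S2 \<longleftrightarrow> S3) \<and> (S3 \<longleftrightarrow> S4)"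
proof -
  have K_lines: "UNIV \<times> {\<alpha>1, \<alpha>2} \<subseteq> K" using assms(3) by auto
  have "S2 \<Longrightarrow> S1" unfolding S1_def S2_def by blast
  moreover have "S1 \<Longrightarrow> S3"
    unfolding S1_def S3_def using representing_imp_recursive[OF assms(1,3)] by blast
  moreover have "S3 \<Longrightarrow> S4"
    unfolding S3_def S4_def
    using psd_mat_M_if_psd_moment_matrix recurrence_if_column_relation[OF assms(1)]
      criterion_if_recursively_generated[OF assms(1,2)] by blast
  moreover have "S4 \<Longrightarrow> S2"
    unfolding S4_def S2_def using rank_atomic_measure_if_criterion[OF assms(1,2) K_lines] by blast
  ultimately show ?thesis by blast
qed

end
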